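(* Let $g\neq 0$ be a strongly operator convex function on $(-\infty,0)$, i.e. $0\neq g\in\mathbf{SOC}(-\infty,0)$, and let $A,B$ be negative invertible operators on a complex Hilbert space. Then $$g(A+B)\leq g(A)+g(B)$$ if and only if $$A(\lambda-B)^{-1}A+B(\lambda-A)^{-1}B\geq 0\quad\text{for every }\lambda\in[0,\infty).$$
   Context: Operators are bounded linear operators on a complex Hilbert space $\mathcal{H}$ (nonzero, otherwise arbitrary). $A\ge 0$ (positive) means $\langle Ax,x\rangle\ge 0$ for all $x\in\mathcal{H}$; $A$ is negative if $-A$ is positive; for self-adjoint $A,B$, $A\le B$ means $B-A\ge 0$. For a scalar $\lambda$, $\lambda-A$ means $\lambda I-A$. For a continuous real function $g$ on an interval $J$ and a self-adjoint $A$ with spectrum in $J$, $g(A)$ is the continuous functional calculus. A continuous real-valued function $g$ on an interval $J$ is strongly operator convex on $J$, written $g\in\mathbf{SOC}(J)$, if $P g(PAP)P\le g(A)$ for every self-adjoint operator $A$ (on any complex Hilbert space) with spectrum in $J$ and every orthogonal projection $P$; here $g(PAP)$ is computed for the compression of $A$ to the range of $P$, so $Pg(PAP)P$ equals $g(PAP|_{P\mathcal{H}})$ on $P\mathcal{H}$ and $0$ on $(P\mathcal{H})^\perp$. *)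

theory Defs
  imports "HOL-Analysis.Analysis" "HOL-Algebra.Algebraic_Closure_Type"
begin

section \<open>Complex Hilbert spaces\<close>

text \<open>Hilbert spaces are records with an explicit carrier set, so that ``every complex Hilbert
  space'' and ``the range of a projection, as a Hilbert space'' can be quantified over and formed
  inside a definition. The fields \<open>monoid.mult\<close> and \<open>one\<close> inherited from modules are unused.\<close>

record 'a chilbert = "(complex, 'a) module" +
  cinner :: "'a \<Rightarrow> 'a \<Rightarrow> complex"

definition hnorm :: "'a chilbert \<Rightarrow> 'a \<Rightarrow> real" where
  "hnorm H x = sqrt (Re (cinner H x x))"

locale chilbert_space = Module.module "ring_of_type_algebra :: complex ring" H
  for H :: "'a chilbert" (structure) +
  assumes cinner_add_left:
      "\<lbrakk>x \<in> carrier H; y \<in> carrier H; z \<in> carrier H\<rbrakk>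
        \<Longrightarrow> cinner H (x \<oplus>\<^bsub>H\<^esub> y) z = cinner H x z + cinner H y z"
    and cinner_smult_left:
      "\<lbrakk>x \<in> carrier H; y \<in> carrier H\<rbrakk> \<Longrightarrow> cinner H (c \<odot>\<^bsub>H\<^esub> x) y = c * cinner H x y"
    and cinner_commute:
      "\<lbrakk>x \<in> carrier H; y \<in> carrier H\<rbrakk> \<Longrightarrow> cinner H x y = cnj (cinner H y x)"
    and cinner_nonneg: "x \<in> carrier H \<Longrightarrow> cinner H x x \<in> \<real>\<^sub>\<ge>\<^sub>0"
    and cinner_definite: "\<lbrakk>x \<in> carrier H; cinner H x x = 0\<rbrakk> \<Longrightarrow> x = \<zero>\<^bsub>H\<^esub>"
    and complete:
      "\<lbrakk>\<And>n. u n \<in> carrier H;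
        \<forall>e>0. \<exists>N::nat. \<forall>m\<ge>N. \<forall>n\<ge>N. hnorm H (u m \<ominus>\<^bsub>H\<^esub> u n) < e\<rbrakk>
        \<Longrightarrow> \<exists>x\<in>carrier H. (\<lambda>n. hnorm H (u n \<ominus>\<^bsub>H\<^esub> x)) \<longlonglongrightarrow> 0"


section \<open>Bounded operators\<close>

text \<open>Operators are extensional functions on the carrier, so that equality of functions is equality
  of operators; the product of operators is \<^const>\<open>compose\<close> on the carrier.\<close>

definition bounded_ops :: "'a chilbert \<Rightarrow> ('a \<Rightarrow> 'a) set" where
  "bounded_ops H = {T \<in> carrier H \<rightarrow>\<^sub>E carrier H.
     (\<forall>x\<in>carrier H. \<forall>y\<in>carrier H. T (x \<oplus>\<^bsub>H\<^esub> y) = T x \<oplus>\<^bsub>H\<^esub> T y) \<and>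
     (\<forall>c. \<forall>x\<in>carrier H. T (c \<odot>\<^bsub>H\<^esub> x) = c \<odot>\<^bsub>H\<^esub> T x) \<and>
     (\<exists>M. \<forall>x\<in>carrier H. hnorm H (T x) \<le> M * hnorm H x)}"

definition op_norm :: "'a chilbert \<Rightarrow> ('a \<Rightarrow> 'a) \<Rightarrow> real" where
  "op_norm H T = (SUP x\<in>{x \<in> carrier H. hnorm H x \<le> 1}. hnorm H (T x))"

definition op_scalar :: "'a chilbert \<Rightarrow> complex \<Rightarrow> 'a \<Rightarrow> 'a" where
  "op_scalar H c = (\<lambda>x\<in>carrier H. c \<odot>\<^bsub>H\<^esub> x)"

definition op_add :: "'a chilbert \<Rightarrow> ('a \<Rightarrow> 'a) \<Rightarrow> ('a \<Rightarrow> 'a) \<Rightarrow> 'a \<Rightarrow> 'a" where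
  "op_add H S T = (\<lambda>x\<in>carrier H. S x \<oplus>\<^bsub>H\<^esub> T x)"

definition op_diff :: "'a chilbert \<Rightarrow> ('a \<Rightarrow> 'a) \<Rightarrow> ('a \<Rightarrow> 'a) \<Rightarrow> 'a \<Rightarrow> 'a" where
  "op_diff H S T = (\<lambda>x\<in>carrier H. S x \<ominus>\<^bsub>H\<^esub> T x)"

definition op_uminus :: "'a chilbert \<Rightarrow> ('a \<Rightarrow> 'a) \<Rightarrow> 'a \<Rightarrow> 'a" where
  "op_uminus H T = (\<lambda>x\<in>carrier H. \<ominus>\<^bsub>H\<^esub> T x)"

definition op_invertible :: "'a chilbert \<Rightarrow> ('a \<Rightarrow> 'a) \<Rightarrow> bool" where
  "op_invertible H T \<longleftrightarrow> (\<exists>S\<in>bounded_ops H.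
     compose (carrier H) S T = op_scalar H 1 \<and> compose (carrier H) T S = op_scalar H 1)"

definition op_inverse :: "'a chilbert \<Rightarrow> ('a \<Rightarrow> 'a) \<Rightarrow> 'a \<Rightarrow> 'a" where
  "op_inverse H T = (\<lambda>x\<in>carrier H. inv_into (carrier H) T x)"

definition op_spectrum :: "'a chilbert \<Rightarrow> ('a \<Rightarrow> 'a) \<Rightarrow> complex set" where
  "op_spectrum H T = {z. \<not> op_invertible H (op_diff H (op_scalar H z) T)}"

definition self_adjoint :: "'a chilbert \<Rightarrow> ('a \<Rightarrow> 'a) \<Rightarrow> bool" where
  "self_adjoint H T \<longleftrightarrow>
     (\<forall>x\<in>carrier H. \<forall>y\<in>carrier H. cinner H (T x) y = cinner H x (T y))"

definition pos_op :: "'a chilbert \<Rightarrow> ('a \<Rightarrow> 'a) \<Rightarrow> bool" where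
  "pos_op H T \<longleftrightarrow> (\<forall>x\<in>carrier H. cinner H (T x) x \<in> \<real>\<^sub>\<ge>\<^sub>0)"

definition neg_op :: "'a chilbert \<Rightarrow> ('a \<Rightarrow> 'a) \<Rightarrow> bool" where
  "neg_op H T \<longleftrightarrow> pos_op H (op_uminus H T)"

definition op_le :: "'a chilbert \<Rightarrow> ('a \<Rightarrow> 'a) \<Rightarrow> ('a \<Rightarrow> 'a) \<Rightarrow> bool" where
  "op_le H S T \<longleftrightarrow> pos_op H (op_diff H T S)"

definition orth_proj :: "'a chilbert \<Rightarrow> ('a \<Rightarrow> 'a) \<Rightarrow> bool" where
  "orth_proj H P \<longleftrightarrow> P \<in> bounded_ops H \<and> self_adjoint H P \<and> compose (carrier H) P P = P"


section \<open>Continuous functional calculus\<close>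

text \<open>Horner evaluation of a real polynomial at an operator, in analogy with \<^const>\<open>poly\<close>.\<close>

definition op_poly :: "'a chilbert \<Rightarrow> real poly \<Rightarrow> ('a \<Rightarrow> 'a) \<Rightarrow> 'a \<Rightarrow> 'a" where
  "op_poly H p T = fold_coeffs
     (\<lambda>a S. op_add H (op_scalar H (complex_of_real a)) (compose (carrier H) T S)) p (op_scalar H 0)"

text \<open>For self-adjoint \<open>T\<close> and \<open>g\<close> continuous on the (real, compact) spectrum of \<open>T\<close>, the operator
  \<open>g(T)\<close> is the norm limit of \<open>p\<^sub>n(T)\<close> for any polynomials \<open>p\<^sub>n\<close> converging to \<open>g\<close> uniformly on the
  spectrum. On the zero space the spectrum is empty and \<open>g(T)\<close> is the zero operator.\<close>

definition cfc :: "'a chilbert \<Rightarrow> (real \<Rightarrow> real) \<Rightarrow> ('a \<Rightarrow> 'a) \<Rightarrow> 'a \<Rightarrow> 'a" where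
  "cfc H g T = (THE S. S \<in> bounded_ops H \<and>
     (\<exists>p :: nat \<Rightarrow> real poly.
        uniform_limit {t. complex_of_real t \<in> op_spectrum H T} (\<lambda>n. poly (p n)) g sequentially \<and>
        (\<lambda>n. op_norm H (op_diff H (op_poly H (p n) T) S)) \<longlonglongrightarrow> 0))"


section \<open>Strong operator convexity\<close>

text \<open>The Hilbert space structure \<open>K\<close> on \<open>P(K)\<close> and the compression of an operator to it.\<close>

definition proj_space :: "'a chilbert \<Rightarrow> ('a \<Rightarrow> 'a) \<Rightarrow> 'a chilbert" where
  "proj_space K P = K\<lparr>carrier := P ` carrier K\<rparr>"

definition compression :: "'a chilbert \<Rightarrow> ('a \<Rightarrow> 'a) \<Rightarrow> ('a \<Rightarrow> 'a) \<Rightarrow> 'a \<Rightarrow> 'a" where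
  "compression K P A = (\<lambda>x\<in>P ` carrier K. P (A x))"

text \<open>\<open>SOC(J)\<close>. HOL cannot quantify over all types inside a definition, so ``any complex Hilbert
  space'' ranges over all Hilbert spaces with carrier contained in a universe type \<open>'u\<close>, which must
  be chosen large enough. For a nonzero Hilbert space \<open>H\<close> with carrier in \<open>'a\<close>, the type
  \<open>nat \<Rightarrow> 'a\<close> is a suitable universe: its subsets carry isometric copies of all countable Hilbert
  sums of copies of \<open>H\<close> and of every separable Hilbert space. A larger universe only strengthens the
  condition, so a theorem assuming it for this universe also covers every larger one. The left-hand operator \<open>P g(PAP) P\<close> is \<open>x \<mapsto> g(PAP|\<^bsub>PK\<^esub>) (P x)\<close>.\<close>

definition soc :: "'u itself \<Rightarrow> real set \<Rightarrow> (real \<Rightarrow> real) \<Rightarrow> bool" where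
  "soc _ J g \<longleftrightarrow> is_interval J \<and> continuous_on J g \<and>
     (\<forall>(K :: 'u chilbert) A P.
        chilbert_space K \<longrightarrow> A \<in> bounded_ops K \<longrightarrow> self_adjoint K A \<longrightarrow>
        op_spectrum K A \<subseteq> complex_of_real ` J \<longrightarrow> orth_proj K P \<longrightarrow>
        op_le K (\<lambda>x\<in>carrier K. cfc (proj_space K P) g (compression K P A) (P x)) (cfc K g A))"

end

theory Submission
  imports Defs
begin

text \<open>Both sides of the equivalence hold for all negative invertible \<open>A\<close> and \<open>B\<close>.

  Cauchy-Schwarz for the form of \<open>-B\<close> turns invertibility into coercivity: \<open>B \<le> -b < 0\<close> for some
  number \<open>b\<close>. For the resolvent condition, let \<open>l \<ge> 0\<close>. Then \<open>l - B\<close> is coercive, so it is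
  bijective by the Lax-Milgram lemma; with \<open>y = (l - B)\<^sup>-\<^sup>1 A x\<close> one gets
  \<open>\<langle>A (l - B)\<^sup>-\<^sup>1 A x, x\<rangle> = \<langle>y, (l - B) y\<rangle> \<ge> 0\<close>, and the same with \<open>A\<close> and \<open>B\<close> exchanged.

  For the operator inequality it suffices that \<open>g(B) \<ge> 0\<close> and \<open>g(A + B) \<le> g(A)\<close>. The first is strong
  operator convexity for the projection \<open>0\<close>. The second says that a strongly operator convex function on
  the negative half-line is operator monotone, and it comes from a dilation. Fix \<open>\<epsilon> > 0\<close>, let
  \<open>E = -\<epsilon> B\<close>, and give pairs the inner product \<open>\<langle>x, x'\<rangle> + \<langle>E y, y'\<rangle>\<close>. On this space let \<open>D\<close> be the
  diagonal operator \<open>(x, y) \<mapsto> (A x, -y / \<epsilon>)\<close> and \<open>P\<close> the projection onto the diagonal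
  \<open>{(x, x)}\<close>. Its compression has the form \<open>\<langle>A x, x\<rangle> - \<langle>E x, x\<rangle> / \<epsilon> = \<langle>(A + B) x, x\<rangle>\<close>, that is, the
  compression acts on the diagonal as \<open>(1 + E)\<^sup>-\<^sup>1 (A + B)\<close>. Strong operator convexity at the vector
  \<open>(k, 0)\<close>, where \<open>g(D)\<close> reduces to \<open>g(A)\<close>, bounds \<open>g\<close> of this operator by \<open>\<langle>g(A) k, k\<rangle>\<close>. As
  \<open>\<epsilon> \<rightarrow> 0\<close> the factor \<open>(1 + E)\<^sup>-\<^sup>1\<close> tends to the identity and the bound becomes
  \<open>\<langle>g(A + B) k, k\<rangle> \<le> \<langle>g(A) k, k\<rangle>\<close>. The weight \<open>E\<close> in the inner product replaces the square root of
  \<open>-B\<close> that the same dilation on an unweighted direct sum would require.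

  The functional calculus enters only through \<open>cfc_approx\<close>: if \<open>m \<le> T \<le> M\<close> and a polynomial
  \<open>q\<close> is within \<open>e\<close> of \<open>g\<close> on \<open>[m, M]\<close>, then \<open>q(T)\<close> is within \<open>e\<close> of \<open>g(T)\<close> in norm. This rests on
  \<open>op_poly_nonneg\<close>: a polynomial that is nonnegative on the spectrum of \<open>T\<close> is positive at \<open>T\<close>.
  Statements that relate different spaces are proved for polynomials, where they are algebra
  (\<open>op_poly_intertwine\<close>), and are then carried over to \<open>g\<close>.\<close>

section \<open>Hilbert space geometry on a carrier\<close>

context chilbert_space
begin

lemma smult_cl [simp]: "x \<in> carrier H \<Longrightarrow> c \<odot> x \<in> carrier H"
  using smult_closed[of c x] by (simp add: ring_of_type_algebra_def)

lemma smult_scalar_add: "x \<in> carrier H \<Longrightarrow> (c + d) \<odot> x = c \<odot> x \<oplus> d \<odot> x"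
  using smult_l_distr[of c d x] by (simp add: ring_of_type_algebra_def)

lemma smult_vector_add:
  "\<lbrakk>x \<in> carrier H; y \<in> carrier H\<rbrakk> \<Longrightarrow> c \<odot> (x \<oplus> y) = c \<odot> x \<oplus> c \<odot> y"
  using smult_r_distr[of c x y] by (simp add: ring_of_type_algebra_def)

lemma smult_smult: "x \<in> carrier H \<Longrightarrow> c \<odot> (d \<odot> x) = (c * d) \<odot> x"
  using smult_assoc1[of c d x] by (simp add: ring_of_type_algebra_def)

lemma smult_1 [simp]: "x \<in> carrier H \<Longrightarrow> 1 \<odot> x = x"
  using smult_one[of x] by (simp add: ring_of_type_algebra_def)

lemma smult_0 [simp]: "x \<in> carrier H \<Longrightarrow> 0 \<odot> x = \<zero>"
  using smult_l_null[of x] by (simp add: ring_of_type_algebra_def)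

lemma smult_zero [simp]: "c \<odot> \<zero> = \<zero>"
  using smult_r_null[of c] by (simp add: ring_of_type_algebra_def)

lemma uminus_eq_smult: assumes "x \<in> carrier H" shows "\<ominus> x = (-1) \<odot> x"
proof -
  have "x \<oplus> (-1) \<odot> x = (1 + (-1)) \<odot> x"
    using assms by (simp only: smult_scalar_add smult_1)
  then have "x \<oplus> (-1) \<odot> x = \<zero>" using assms by simp
  then show ?thesis using assms M.minus_equality M.add.m_comm smult_cl by metis
qed

lemma diff_eq_smult: "\<lbrakk>x \<in> carrier H; y \<in> carrier H\<rbrakk> \<Longrightarrow> x \<ominus> y = x \<oplus> (-1) \<odot> y"
  by (simp add: a_minus_def uminus_eq_smult)

lemma diff_eq_zero_iff:
  assumes "x \<in> carrier H" "y \<in> carrier H" shows "x \<ominus> y = \<zero> \<longleftrightarrow> x = y"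
proof
  assume "x \<ominus> y = \<zero>"
  moreover have "x = (x \<ominus> y) \<oplus> y"
    using assms by (simp add: M.minus_eq M.a_assoc M.l_neg)
  ultimately show "x = y" using assms by simp
qed (use assms in \<open>simp add: M.minus_eq M.r_neg\<close>)

lemma cinner_diff_left:
  "\<lbrakk>x \<in> carrier H; y \<in> carrier H; z \<in> carrier H\<rbrakk>
    \<Longrightarrow> cinner H (x \<ominus> y) z = cinner H x z - cinner H y z"
  by (simp add: diff_eq_smult cinner_add_left cinner_smult_left)

lemma cinner_zero_left [simp]: "x \<in> carrier H \<Longrightarrow> cinner H \<zero> x = 0"
  using cinner_smult_left[of x x 0] by simp

lemma cinner_zero_right [simp]: "x \<in> carrier H \<Longrightarrow> cinner H x \<zero> = 0"
  using cinner_commute[of x "\<zero>"] by simp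

lemma cinner_add_right:
  "\<lbrakk>x \<in> carrier H; y \<in> carrier H; z \<in> carrier H\<rbrakk>
    \<Longrightarrow> cinner H z (x \<oplus> y) = cinner H z x + cinner H z y"
  using cinner_commute[of z "x \<oplus> y"] cinner_commute[of z x] cinner_commute[of z y]
  by (simp add: cinner_add_left)

lemma cinner_smult_right:
  "\<lbrakk>x \<in> carrier H; y \<in> carrier H\<rbrakk> \<Longrightarrow> cinner H x (c \<odot> y) = cnj c * cinner H x y"
  using cinner_commute[of x "c \<odot> y"] cinner_commute[of x y]
  by (simp add: cinner_smult_left)

lemma cinner_diff_right:
  "\<lbrakk>x \<in> carrier H; y \<in> carrier H; z \<in> carrier H\<rbrakk>
    \<Longrightarrow> cinner H z (x \<ominus> y) = cinner H z x - cinner H z y"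
  by (simp add: diff_eq_smult cinner_add_right cinner_smult_right)

lemmas cinner_linear = cinner_add_left cinner_add_right cinner_diff_left cinner_diff_right
  cinner_smult_left cinner_smult_right

lemma hnorm_ge0 [simp]: "x \<in> carrier H \<Longrightarrow> 0 \<le> hnorm H x"
  unfolding hnorm_def using cinner_nonneg[of x]
  by (auto simp: complex_nonneg_Reals_iff)

lemma cinner_self: "x \<in> carrier H \<Longrightarrow> cinner H x x = of_real ((hnorm H x)\<^sup>2)"
  unfolding hnorm_def using cinner_nonneg[of x]
  by (auto simp: complex_eq_iff complex_nonneg_Reals_iff)

lemma hnorm_square: "x \<in> carrier H \<Longrightarrow> (hnorm H x)\<^sup>2 = Re (cinner H x x)"
  by (simp add: cinner_self)

lemma hnorm_zero [simp]: "hnorm H \<zero> = 0"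
  by (simp add: hnorm_def)

lemma hnorm_eq_0_iff [simp]: "x \<in> carrier H \<Longrightarrow> hnorm H x = 0 \<longleftrightarrow> x = \<zero>"
  using cinner_definite[of x] cinner_self[of x] by auto

text \<open>A nondegenerate inner product tests equality, so vector identities reduce to identities
  between complex numbers.\<close>

lemma cinner_ext:
  assumes "x \<in> carrier H" "y \<in> carrier H"
    and "\<And>z. z \<in> carrier H \<Longrightarrow> cinner H x z = cinner H y z"
  shows "x = y"
proof -
  have "cinner H (x \<ominus> y) (x \<ominus> y) = 0"
    using assms by (simp add: cinner_linear)
  then have "x \<ominus> y = \<zero>"
    using assms by (intro cinner_definite) auto
  then show ?thesis using assms by (simp add: diff_eq_zero_iff)
qed

lemma Cauchy_Schwarz:
  assumes x: "x \<in> carrier H" and y: "y \<in> carrier H"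
  shows "cmod (cinner H x y) \<le> hnorm H x * hnorm H y"
proof (cases "y = \<zero>")
  case True
  then show ?thesis using x by simp
next
  case False
  let ?n = "(hnorm H y)\<^sup>2"
  have n: "?n > 0" using False y by simp
  define c where "c = cinner H x y / of_real ?n"
  let ?z = "x \<ominus> c \<odot> y"
  have z: "?z \<in> carrier H" using x y by simp
  have yx: "cinner H y x = cnj (cinner H x y)" by (rule cinner_commute[OF y x])
  have "cinner H ?z ?z = cinner H x x - c * cnj (cinner H x y)"
    using x y n by (simp add: cinner_linear yx c_def cinner_self[OF y] field_simps power2_eq_square)
  also have "c * cnj (cinner H x y) = of_real ((cmod (cinner H x y))\<^sup>2 / ?n)"
    unfolding c_def using complex_norm_square[of "cinner H x y"] by (simp)
  finally have "(hnorm H ?z)\<^sup>2 = (hnorm H x)\<^sup>2 - (cmod (cinner H x y))\<^sup>2 / ?n"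
    using x z by (simp add: hnorm_square[OF z] cinner_self[OF x])
  then have "(cmod (cinner H x y))\<^sup>2 / ?n \<le> (hnorm H x)\<^sup>2"
    by (metis diff_ge_0_iff_ge zero_le_power2)
  then have "(cmod (cinner H x y))\<^sup>2 \<le> (hnorm H x * hnorm H y)\<^sup>2"
    using n by (simp add: field_simps power_mult_distrib)
  then show ?thesis using x y by (meson power2_le_imp_le hnorm_ge0 mult_nonneg_nonneg)
qed

lemma Re_cinner_le: "\<lbrakk>x \<in> carrier H; y \<in> carrier H\<rbrakk> \<Longrightarrow> \<bar>Re (cinner H x y)\<bar> \<le> hnorm H x * hnorm H y"
  using Cauchy_Schwarz[of x y] abs_Re_le_cmod[of "cinner H x y"] by linarith

lemma hnorm_add_le:
  assumes x: "x \<in> carrier H" and y: "y \<in> carrier H"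
  shows "hnorm H (x \<oplus> y) \<le> hnorm H x + hnorm H y"
proof -
  have "(hnorm H (x \<oplus> y))\<^sup>2 = (hnorm H x)\<^sup>2 + 2 * Re (cinner H x y) + (hnorm H y)\<^sup>2"
    using x y cinner_commute[OF y x] by (simp add: hnorm_square cinner_linear)
  also have "\<dots> \<le> (hnorm H x + hnorm H y)\<^sup>2"
    using Re_cinner_le[OF x y] by (simp add: power2_sum)
  finally show ?thesis using x y by (meson power2_le_imp_le hnorm_ge0 add_nonneg_nonneg)
qed

lemma hnorm_smult [simp]:
  assumes x: "x \<in> carrier H" shows "hnorm H (c \<odot> x) = cmod c * hnorm H x"
proof -
  have "cinner H (c \<odot> x) (c \<odot> x) = c * cnj c * cinner H x x"
    using x by (simp add: cinner_linear mult.assoc)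
  then have "(hnorm H (c \<odot> x))\<^sup>2 = Re (c * cnj c * cinner H x x)"
    using x by (simp only: hnorm_square smult_cl)
  also have "\<dots> = (cmod c * hnorm H x)\<^sup>2"
    unfolding cinner_self[OF x] complex_norm_square[symmetric]
    by (simp only: Re_complex_of_real power_mult_distrib flip: of_real_power of_real_mult)
  finally show ?thesis using x by (simp add: power2_eq_iff_nonneg)
qed

lemma hnorm_diff_sym:
  assumes "x \<in> carrier H" "y \<in> carrier H" shows "hnorm H (x \<ominus> y) = hnorm H (y \<ominus> x)"
proof -
  have "x \<ominus> y = (-1) \<odot> (y \<ominus> x)"
    using assms by (intro cinner_ext) (auto simp: cinner_linear)
  then show ?thesis using assms by simp
qed

lemma hnorm_diff_triangle:
  assumes "x \<in> carrier H" "y \<in> carrier H" "z \<in> carrier H"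
  shows "hnorm H (x \<ominus> z) \<le> hnorm H (x \<ominus> y) + hnorm H (y \<ominus> z)"
proof -
  have "x \<ominus> z = (x \<ominus> y) \<oplus> (y \<ominus> z)"
    using assms by (intro cinner_ext) (auto simp: cinner_linear)
  then show ?thesis using assms by (simp add: hnorm_add_le)
qed

lemma hnorm_diff_le:
  assumes "x \<in> carrier H" "y \<in> carrier H"
  shows "hnorm H x \<le> hnorm H (x \<ominus> y) + hnorm H y"
proof -
  have "x = (x \<ominus> y) \<oplus> y"
    using assms by (intro cinner_ext) (auto simp: cinner_linear)
  then show ?thesis using assms hnorm_add_le[of "x \<ominus> y" y] by simp
qed

lemma diff_self [simp]: "x \<in> carrier H \<Longrightarrow> x \<ominus> x = \<zero>"
  by (intro cinner_ext) (auto simp: cinner_linear)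

text \<open>The distance is cut off outside the carrier only to make it symmetric there.\<close>

definition hdist :: "'a \<Rightarrow> 'a \<Rightarrow> real" where
  "hdist x y = (if x \<in> carrier H \<and> y \<in> carrier H then hnorm H (x \<ominus> y) else 0)"

lemma hdist_metric: "Metric_space (carrier H) hdist"
  by unfold_locales (auto simp: hdist_def hnorm_diff_sym hnorm_diff_triangle diff_eq_zero_iff)

lemma hdist_mcomplete: "Metric_space.mcomplete (carrier H) hdist"
proof -
  interpret Metric_space "carrier H" hdist by (rule hdist_metric)
  show ?thesis
    unfolding mcomplete_def
  proof (intro allI impI)
    fix u assume "MCauchy u"
    then have u: "\<And>n. u n \<in> carrier H"
      and cau: "\<forall>e>0. \<exists>N. \<forall>m\<ge>N. \<forall>n\<ge>N. hnorm H (u m \<ominus> u n) < e"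
      unfolding MCauchy_def hdist_def by (auto simp: image_subset_iff)
    then obtain x where "x \<in> carrier H" "(\<lambda>n. hnorm H (u n \<ominus> x)) \<longlonglongrightarrow> 0"
      using complete by blast
    then show "\<exists>x. limitin mtopology u x sequentially"
      using u by (intro exI[of _ x]) (auto simp: limitin_metric_dist_null hdist_def)
  qed
qed

end

section \<open>Bounded operators and the Lax-Milgram lemma\<close>

context chilbert_space
begin

lemma op_closed [simp]: "\<lbrakk>T \<in> bounded_ops H; x \<in> carrier H\<rbrakk> \<Longrightarrow> T x \<in> carrier H"
  by (auto simp: bounded_ops_def)

lemma op_vector_add:
  "\<lbrakk>T \<in> bounded_ops H; x \<in> carrier H; y \<in> carrier H\<rbrakk> \<Longrightarrow> T (x \<oplus> y) = T x \<oplus> T y"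
  by (auto simp: bounded_ops_def)

lemma op_vector_smult:
  "\<lbrakk>T \<in> bounded_ops H; x \<in> carrier H\<rbrakk> \<Longrightarrow> T (c \<odot> x) = c \<odot> T x"
  by (auto simp: bounded_ops_def)

lemma op_vector_diff:
  "\<lbrakk>T \<in> bounded_ops H; x \<in> carrier H; y \<in> carrier H\<rbrakk> \<Longrightarrow> T (x \<ominus> y) = T x \<ominus> T y"
  by (simp add: diff_eq_smult op_vector_add op_vector_smult)

lemma op_vector_zero [simp]: "T \<in> bounded_ops H \<Longrightarrow> T \<zero> = \<zero>"
  using op_vector_smult[of T "\<zero>" 0] by simp

lemmas op_linear = op_vector_add op_vector_diff op_vector_smult

lemma op_bound:
  assumes "T \<in> bounded_ops H"
  obtains M where "M > 0" "\<And>x. x \<in> carrier H \<Longrightarrow> hnorm H (T x) \<le> M * hnorm H x"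
proof -
  obtain M where M: "\<forall>x\<in>carrier H. hnorm H (T x) \<le> M * hnorm H x"
    using assms by (auto simp: bounded_ops_def)
  have "hnorm H (T x) \<le> max M 1 * hnorm H x" if "x \<in> carrier H" for x
    using M that mult_right_mono[of M "max M 1" "hnorm H x"] hnorm_ge0[OF that] by fastforce
  then show ?thesis using that[of "max M 1"] by auto
qed

lemma op_form_bound:
  assumes T: "T \<in> bounded_ops H"
  shows "\<exists>N>0. \<forall>x\<in>carrier H. hnorm H (T x) \<le> N * hnorm H x
    \<and> - N * (hnorm H x)\<^sup>2 \<le> Re (cinner H (T x) x) \<and> Re (cinner H (T x) x) \<le> N * (hnorm H x)\<^sup>2"
proof -
  obtain N where N: "N > 0" "\<And>x. x \<in> carrier H \<Longrightarrow> hnorm H (T x) \<le> N * hnorm H x"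
    using op_bound[OF T] by blast
  have "\<bar>Re (cinner H (T x) x)\<bar> \<le> N * (hnorm H x)\<^sup>2" if x: "x \<in> carrier H" for x
  proof -
    have "\<bar>Re (cinner H (T x) x)\<bar> \<le> hnorm H (T x) * hnorm H x"
      using Re_cinner_le[of "T x" x] T x by simp
    also have "\<dots> \<le> N * hnorm H x * hnorm H x"
      using N(2)[OF x] x by (intro mult_right_mono) auto
    finally show ?thesis by (simp add: power2_eq_square mult.assoc)
  qed
  then have "- N * (hnorm H x)\<^sup>2 \<le> Re (cinner H (T x) x)" "Re (cinner H (T x) x) \<le> N * (hnorm H x)\<^sup>2"
    if "x \<in> carrier H" for x
    using that by (fastforce simp: abs_le_iff)+
  then show ?thesis using N by blast
qed

lemma bounded_opsI:
  assumes "\<And>x. x \<in> carrier H \<Longrightarrow> T x \<in> carrier H"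
    and "\<And>x. x \<notin> carrier H \<Longrightarrow> T x = undefined"
    and "\<And>x y. \<lbrakk>x \<in> carrier H; y \<in> carrier H\<rbrakk> \<Longrightarrow> T (x \<oplus> y) = T x \<oplus> T y"
    and "\<And>c x. x \<in> carrier H \<Longrightarrow> T (c \<odot> x) = c \<odot> T x"
    and "\<And>x. x \<in> carrier H \<Longrightarrow> hnorm H (T x) \<le> M * hnorm H x"
  shows "T \<in> bounded_ops H"
proof -
  have "\<exists>M. \<forall>x\<in>carrier H. hnorm H (T x) \<le> M * hnorm H x" using assms(5) by blast
  then show ?thesis
    using assms(1-4) unfolding bounded_ops_def by (simp add: PiE_def extensional_def)
qed

lemma bounded_ops_ext:
  assumes "S \<in> bounded_ops H" "T \<in> bounded_ops H" "\<And>x. x \<in> carrier H \<Longrightarrow> S x = T x"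
  shows "S = T"
  using assms unfolding bounded_ops_def by (auto intro: PiE_ext)

lemma op_scalar_bounded [simp]: "op_scalar H c \<in> bounded_ops H"
  by (rule bounded_opsI[where M = "cmod c"])
    (auto simp: op_scalar_def smult_vector_add smult_smult mult.commute)

lemma op_add_bounded [simp]:
  assumes "S \<in> bounded_ops H" "T \<in> bounded_ops H" shows "op_add H S T \<in> bounded_ops H"
proof -
  obtain M where M: "\<And>x. x \<in> carrier H \<Longrightarrow> hnorm H (S x) \<le> M * hnorm H x"
    using op_bound[OF assms(1)] by blast
  obtain N where N: "\<And>x. x \<in> carrier H \<Longrightarrow> hnorm H (T x) \<le> N * hnorm H x"
    using op_bound[OF assms(2)] by blast
  show ?thesis
  proof (rule bounded_opsI[where M = "M + N"])
    fix x y assume x: "x \<in> carrier H" "y \<in> carrier H"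
    show "op_add H S T (x \<oplus> y) = op_add H S T x \<oplus> op_add H S T y"
      using assms x by (simp add: op_add_def op_vector_add M.add.m_ac)
  next
    fix x assume x: "x \<in> carrier H"
    show "hnorm H (op_add H S T x) \<le> (M + N) * hnorm H x"
      using assms x M[OF x] N[OF x] hnorm_add_le[of "S x" "T x"]
      by (simp add: op_add_def algebra_simps)
  qed (use assms in \<open>auto simp: op_add_def op_vector_smult smult_vector_add\<close>)
qed

lemma op_compose_bounded [simp]:
  assumes "S \<in> bounded_ops H" "T \<in> bounded_ops H"
  shows "compose (carrier H) S T \<in> bounded_ops H"
proof -
  obtain M where M: "M > 0" "\<And>x. x \<in> carrier H \<Longrightarrow> hnorm H (S x) \<le> M * hnorm H x"
    using op_bound[OF assms(1)] by blast
  obtain N where N: "\<And>x. x \<in> carrier H \<Longrightarrow> hnorm H (T x) \<le> N * hnorm H x"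
    using op_bound[OF assms(2)] by blast
  show ?thesis
  proof (rule bounded_opsI[where M = "M * N"])
    fix x assume x: "x \<in> carrier H"
    have "hnorm H (S (T x)) \<le> M * hnorm H (T x)" using assms x M by simp
    also have "\<dots> \<le> M * (N * hnorm H x)" using M N[OF x] by simp
    finally show "hnorm H (compose (carrier H) S T x) \<le> M * N * hnorm H x"
      using x by (simp add: compose_def mult.assoc)
  qed (use assms in \<open>auto simp: compose_def op_linear\<close>)
qed

lemma op_diff_eq:
  assumes "S \<in> bounded_ops H" "T \<in> bounded_ops H"
  shows "op_diff H S T = op_add H S (compose (carrier H) (op_scalar H (-1)) T)"
  using assms by (auto simp: op_diff_def op_add_def op_scalar_def compose_def diff_eq_smult)

lemma op_diff_bounded [simp]:
  assumes "S \<in> bounded_ops H" "T \<in> bounded_ops H" shows "op_diff H S T \<in> bounded_ops H"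
  using assms by (simp add: op_diff_eq)

lemma op_invertible_below:
  assumes "T \<in> bounded_ops H" "op_invertible H T"
  obtains d where "d > 0" "\<And>x. x \<in> carrier H \<Longrightarrow> d * hnorm H x \<le> hnorm H (T x)"
proof -
  obtain S where S: "S \<in> bounded_ops H" "compose (carrier H) S T = op_scalar H 1"
    using assms by (auto simp: op_invertible_def)
  obtain M where M: "M > 0" "\<And>x. x \<in> carrier H \<Longrightarrow> hnorm H (S x) \<le> M * hnorm H x"
    using op_bound[OF S(1)] by blast
  have "inverse M * hnorm H x \<le> hnorm H (T x)" if x: "x \<in> carrier H" for x
  proof -
    have "S (T x) = x"
      using fun_cong[OF S(2), of x] x by (simp add: compose_def op_scalar_def)
    then have "hnorm H x \<le> M * hnorm H (T x)"
      using M(2)[of "T x"] assms(1) x by simp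
    then show ?thesis using M(1) by (simp add: field_simps)
  qed
  then show ?thesis using that[of "inverse M"] M(1) by simp
qed

text \<open>Lax-Milgram: for a small step \<open>t\<close> the map \<open>x \<mapsto> x - t c (S x - y)\<close> is a contraction, because
  \<open>|x - t c S x|\<^sup>2 \<le> (1 - 2 t d + t\<^sup>2 M\<^sup>2) |x|\<^sup>2\<close>; its fixed point solves \<open>S x = y\<close>. The phase \<open>c\<close> lets
  the coercive direction be any direction of the complex plane.\<close>

lemma Lax_Milgram:
  assumes S: "S \<in> bounded_ops H" and c: "cmod c = 1" and d: "d > 0"
    and coercive: "\<And>x. x \<in> carrier H \<Longrightarrow> d * (hnorm H x)\<^sup>2 \<le> Re (c * cinner H (S x) x)"
  shows "op_invertible H S" "bij_betw S (carrier H) (carrier H)"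
proof -
  obtain M where M: "M > 0" "\<And>x. x \<in> carrier H \<Longrightarrow> hnorm H (S x) \<le> M * hnorm H x"
    using op_bound[OF S] by blast
  have below: "d * hnorm H x \<le> hnorm H (S x)" if x: "x \<in> carrier H" for x
  proof -
    have "d * (hnorm H x)\<^sup>2 \<le> cmod (c * cinner H (S x) x)"
      using coercive[OF x] complex_Re_le_cmod order_trans by blast
    also have "\<dots> \<le> hnorm H (S x) * hnorm H x"
      using Cauchy_Schwarz[of "S x" x] S x c by (simp add: norm_mult)
    finally have "(d * hnorm H x) * hnorm H x \<le> hnorm H (S x) * hnorm H x"
      by (simp add: power2_eq_square mult.assoc)
    then show ?thesis
      using S x hnorm_ge0[OF x] by (cases "hnorm H x = 0") (auto simp: mult_le_cancel_right)
  qed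
  have inj: "inj_on S (carrier H)"
  proof (rule inj_onI)
    fix x y assume xy: "x \<in> carrier H" "y \<in> carrier H" "S x = S y"
    then have "d * hnorm H (x \<ominus> y) \<le> hnorm H (S (x \<ominus> y))" by (intro below) simp
    also have "\<dots> = 0" using S xy by (simp add: op_linear)
    finally have "hnorm H (x \<ominus> y) \<le> 0"
      using d by (simp add: mult_le_0_iff)
    then have "hnorm H (x \<ominus> y) = 0"
      using xy hnorm_ge0[of "x \<ominus> y"] M.minus_closed by fastforce
    then show "x = y" using xy by (simp add: diff_eq_zero_iff)
  qed
  have surj: "\<exists>x\<in>carrier H. S x = y" if y: "y \<in> carrier H" for y
  proof -
    interpret Metric_space "carrier H" hdist by (rule hdist_metric)
    \<comment> \<open>This \<open>t\<close> minimizes \<open>1 - 2 t d + t\<^sup>2 M\<^sup>2\<close>; the minimum is \<open>1 - d\<^sup>2 / M\<^sup>2\<close>.\<close>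
    define t where "t = d / M\<^sup>2"
    define k where "k = sqrt (max 0 (1 - d\<^sup>2 / M\<^sup>2))"
    have t: "t > 0" using d M by (simp add: t_def)
    have k: "k < 1" using d M by (auto simp: k_def)
    define f where "f x = x \<ominus> (of_real t * c) \<odot> (S x \<ominus> y)" for x
    have f: "f x \<in> carrier H" if "x \<in> carrier H" for x using that S y by (simp add: f_def)
    have step: "hnorm H (z \<ominus> (of_real t * c) \<odot> S z) \<le> k * hnorm H z" if z: "z \<in> carrier H" for z
    proof -
      let ?w = "z \<ominus> (of_real t * c) \<odot> S z"
      have Sz: "S z \<in> carrier H" using S z by simp
      have cc: "c * cnj c = 1" using c by (simp add: complex_norm_square[symmetric])
      have zS: "cinner H z (S z) = cnj (cinner H (S z) z)" by (rule cinner_commute[OF z Sz])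
      have "cinner H ?w ?w = cinner H z z - of_real t * (c * cinner H (S z) z)
          - of_real t * cnj (c * cinner H (S z) z) + of_real (t\<^sup>2) * (c * cnj c) * cinner H (S z) (S z)"
        using z Sz by (simp add: cinner_linear zS algebra_simps power2_eq_square)
      then have "(hnorm H ?w)\<^sup>2 = (hnorm H z)\<^sup>2 - 2 * t * Re (c * cinner H (S z) z) + t\<^sup>2 * (hnorm H (S z))\<^sup>2"
        using z Sz unfolding cc by (simp add: hnorm_square[of ?w] cinner_self[OF z] cinner_self[OF Sz])
      also have "\<dots> \<le> (hnorm H z)\<^sup>2 - 2 * t * (d * (hnorm H z)\<^sup>2) + t\<^sup>2 * (M * hnorm H z)\<^sup>2"
        using coercive[OF z] M(2)[OF z] t Sz z
        by (intro add_mono diff_mono mult_left_mono power_mono) auto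
      also have "\<dots> = (1 - d\<^sup>2 / M\<^sup>2) * (hnorm H z)\<^sup>2"
        using M(1) by (simp add: t_def field_simps power2_eq_square)
      also have "\<dots> \<le> k\<^sup>2 * (hnorm H z)\<^sup>2"
        by (intro mult_right_mono) (auto simp: k_def)
      finally have "(hnorm H ?w)\<^sup>2 \<le> (k * hnorm H z)\<^sup>2" by (simp add: power_mult_distrib)
      then show ?thesis by (rule power2_le_imp_le) (use z in \<open>auto simp: k_def\<close>)
    qed
    have contraction: "hdist (f x) (f x') \<le> k * hdist x x'" if x: "x \<in> carrier H" "x' \<in> carrier H" for x x'
    proof -
      have "f x \<ominus> f x' = (x \<ominus> x') \<ominus> (of_real t * c) \<odot> S (x \<ominus> x')"
        unfolding f_def using x y S by (intro cinner_ext) (auto simp: cinner_linear op_linear algebra_simps)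
      then show ?thesis using step[of "x \<ominus> x'"] x f by (simp add: hdist_def)
    qed
    obtain x where x: "x \<in> carrier H" "f x = x"
      by (rule Banach_fixedpoint_thm[OF hdist_mcomplete, of f k])
        (use y f k contraction in auto)
    have Sx: "S x \<in> carrier H" using S x by simp
    have "(of_real t * c) \<odot> (S x \<ominus> y) = x \<ominus> f x"
      unfolding f_def using x y Sx by (intro cinner_ext) (auto simp: cinner_linear)
    also have "\<dots> = \<zero>" using x by simp
    finally have "cmod (of_real t * c) * hnorm H (S x \<ominus> y) = 0"
      using Sx y hnorm_smult[of "S x \<ominus> y" "of_real t * c"] by simp
    then have "S x \<ominus> y = \<zero>" using t c Sx y by (simp add: norm_mult)
    then have "S x = y" using Sx y by (simp add: diff_eq_zero_iff)
    then show ?thesis using x(1) by blast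
  qed
  show bij: "bij_betw S (carrier H) (carrier H)"
    unfolding bij_betw_def using inj
  proof
    show "S ` carrier H = carrier H" using S surj by (auto simp: image_iff)
  qed
  define R where "R = (\<lambda>y\<in>carrier H. inv_into (carrier H) S y)"
  have R: "R y \<in> carrier H" "S (R y) = y" if "y \<in> carrier H" for y
    using bij that by (auto simp: R_def bij_betw_def inv_into_into f_inv_into_f)
  have RS: "R (S x) = x" if "x \<in> carrier H" for x
    using inj that S by (simp add: R_def)
  have "R \<in> bounded_ops H"
  proof (rule bounded_opsI[where M = "1 / d"])
    fix x y assume xy: "x \<in> carrier H" "y \<in> carrier H"
    have "S (R x \<oplus> R y) = x \<oplus> y" using xy R S by (simp add: op_linear)
    then show "R (x \<oplus> y) = R x \<oplus> R y" using RS[of "R x \<oplus> R y"] R xy by simp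
  next
    fix a x assume x: "x \<in> carrier H"
    have "S (a \<odot> R x) = a \<odot> x" using x R S by (simp add: op_linear)
    then show "R (a \<odot> x) = a \<odot> R x" using RS[of "a \<odot> R x"] R x by simp
  next
    fix x assume x: "x \<in> carrier H"
    show "hnorm H (R x) \<le> 1 / d * hnorm H x"
      using below[of "R x"] R[OF x] d by (simp add: field_simps)
  qed (use R in \<open>auto simp: R_def\<close>)
  then show "op_invertible H S"
    unfolding op_invertible_def using R RS
    by (intro bexI[of _ R] conjI ext) (simp_all add: compose_def op_scalar_def)
qed

end

section \<open>Limits of vectors\<close>

context chilbert_space
begin

definition vlim :: "(nat \<Rightarrow> 'a) \<Rightarrow> 'a \<Rightarrow> bool" where
  "vlim u x \<longleftrightarrow> (\<lambda>n. hnorm H (u n \<ominus> x)) \<longlonglongrightarrow> 0"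

lemma vlimI:
  assumes "\<And>n. u n \<in> carrier H" "x \<in> carrier H" "\<And>n. hnorm H (u n \<ominus> x) \<le> b n" "b \<longlonglongrightarrow> 0"
  shows "vlim u x"
  unfolding vlim_def using assms
  by (intro tendsto_sandwich[OF _ _ tendsto_const assms(4)]) (auto intro!: always_eventually)

lemma vlim_unique:
  assumes u: "\<And>n. u n \<in> carrier H" "x \<in> carrier H" "y \<in> carrier H" and "vlim u x" "vlim u y"
  shows "x = y"
proof -
  have "(\<lambda>n. hnorm H (u n \<ominus> x) + hnorm H (u n \<ominus> y)) \<longlonglongrightarrow> 0 + 0"
    using assms unfolding vlim_def by (intro tendsto_add)
  moreover have "hnorm H (x \<ominus> y) \<le> hnorm H (u n \<ominus> x) + hnorm H (u n \<ominus> y)" for n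
    using u hnorm_diff_triangle[of x "u n" y] hnorm_diff_sym[of x "u n"] by simp
  ultimately have "hnorm H (x \<ominus> y) \<le> 0"
    by (intro LIMSEQ_le_const[of _ "0"]) auto
  then have "hnorm H (x \<ominus> y) = 0"
    using u hnorm_ge0[of "x \<ominus> y"] M.minus_closed by fastforce
  then show ?thesis using u by (simp add: diff_eq_zero_iff)
qed

lemma vlim_add:
  assumes u: "\<And>n. u n \<in> carrier H" "x \<in> carrier H" "\<And>n. v n \<in> carrier H" "y \<in> carrier H"
    and "vlim u x" "vlim v y"
  shows "vlim (\<lambda>n. u n \<oplus> v n) (x \<oplus> y)"
proof (rule vlimI[where b = "\<lambda>n. hnorm H (u n \<ominus> x) + hnorm H (v n \<ominus> y)"])
  fix n
  have "(u n \<oplus> v n) \<ominus> (x \<oplus> y) = (u n \<ominus> x) \<oplus> (v n \<ominus> y)"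
    using u by (intro cinner_ext) (auto simp: cinner_linear)
  then show "hnorm H ((u n \<oplus> v n) \<ominus> (x \<oplus> y)) \<le> hnorm H (u n \<ominus> x) + hnorm H (v n \<ominus> y)"
    using u by (simp add: hnorm_add_le)
  show "(\<lambda>n. hnorm H (u n \<ominus> x) + hnorm H (v n \<ominus> y)) \<longlonglongrightarrow> 0"
    using tendsto_add[OF assms(5,6)[unfolded vlim_def]] by simp
qed (use u in auto)

lemma vlim_op:
  assumes u: "\<And>n. u n \<in> carrier H" "x \<in> carrier H" and "vlim u x" and T: "T \<in> bounded_ops H"
  shows "vlim (\<lambda>n. T (u n)) (T x)"
proof -
  obtain M where M: "\<And>x. x \<in> carrier H \<Longrightarrow> hnorm H (T x) \<le> M * hnorm H x"
    using op_bound[OF T] by blast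
  show ?thesis
  proof (rule vlimI[where b = "\<lambda>n. M * hnorm H (u n \<ominus> x)"])
    show "hnorm H (T (u n) \<ominus> T x) \<le> M * hnorm H (u n \<ominus> x)" for n
      using M[of "u n \<ominus> x"] u T by (simp add: op_linear)
    show "(\<lambda>n. M * hnorm H (u n \<ominus> x)) \<longlonglongrightarrow> 0"
      using tendsto_mult_right_zero[OF assms(3)[unfolded vlim_def]] by simp
  qed (use u T in auto)
qed

lemma vlim_smult:
  assumes u: "\<And>n. u n \<in> carrier H" "x \<in> carrier H" and "vlim u x"
  shows "vlim (\<lambda>n. c \<odot> u n) (c \<odot> x)"
  using vlim_op[OF assms op_scalar_bounded[of c]] u by (simp add: op_scalar_def)

end

section \<open>Polynomials of a self-adjoint operator\<close>

context chilbert_space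
begin

lemma op_poly_0 [simp]: "x \<in> carrier H \<Longrightarrow> op_poly H 0 T x = \<zero>"
  by (simp add: op_poly_def op_scalar_def)

lemma op_poly_bounded [simp]:
  assumes T: "T \<in> bounded_ops H" shows "op_poly H p T \<in> bounded_ops H"
proof (induction p)
  case 0
  show ?case by (simp add: op_poly_def)
next
  case (pCons a p)
  then have "op_poly H (pCons a p) T
      = op_add H (op_scalar H (complex_of_real a)) (compose (carrier H) T (op_poly H p T))"
    by (auto simp: op_poly_def)
  then show ?case using pCons T by simp
qed

lemma op_poly_pCons [simp]:
  assumes "T \<in> bounded_ops H" "x \<in> carrier H"
  shows "op_poly H (pCons a p) T x = of_real a \<odot> x \<oplus> T (op_poly H p T x)"
proof (cases "a = 0 \<and> p = 0")
  case True
  then show ?thesis using assms by simp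
next
  case False
  then have "op_poly H (pCons a p) T
      = op_add H (op_scalar H (complex_of_real a)) (compose (carrier H) T (op_poly H p T))"
    by (auto simp: op_poly_def)
  then show ?thesis using assms by (simp add: op_add_def op_scalar_def compose_def)
qed

context
  fixes T assumes T [simp]: "T \<in> bounded_ops H"
begin

lemma op_poly_add:
  "x \<in> carrier H \<Longrightarrow> op_poly H (p + q) T x = op_poly H p T x \<oplus> op_poly H q T x"
  by (induction p q rule: poly_induct2)
    (simp_all add: smult_scalar_add op_vector_add M.add.m_ac)

lemma op_poly_smult:
  "x \<in> carrier H \<Longrightarrow> op_poly H (Polynomial.smult c p) T x = of_real c \<odot> op_poly H p T x"
  by (induction p) (simp_all add: smult_vector_add smult_smult op_vector_smult)

lemma op_poly_diff:
  "x \<in> carrier H \<Longrightarrow> op_poly H (p - q) T x = op_poly H p T x \<ominus> op_poly H q T x"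
  using op_poly_add[of x p "- q"] op_poly_smult[of x "-1" q] by (simp add: diff_eq_smult)

lemma op_poly_mult:
  "x \<in> carrier H \<Longrightarrow> op_poly H (p * q) T x = op_poly H p T (op_poly H q T x)"
  by (induction p) (simp_all add: op_poly_add op_poly_smult)

lemma op_poly_commute:
  "x \<in> carrier H \<Longrightarrow> op_poly H p T (T x) = T (op_poly H p T x)"
  by (induction p) (simp_all add: op_linear)

lemma op_poly_adjoint:
  assumes sa: "self_adjoint H T" and x: "x \<in> carrier H" and y: "y \<in> carrier H"
  shows "cinner H (op_poly H p T x) y = cinner H x (op_poly H p T y)"
  using x y
proof (induction p arbitrary: y)
  case (pCons a p)
  have "cinner H (T (op_poly H p T x)) y = cinner H (op_poly H p T x) (T y)"
    using sa pCons.prems by (simp add: self_adjoint_def)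
  also have "\<dots> = cinner H x (T (op_poly H p T y))"
    using pCons by (simp add: op_poly_commute)
  finally show ?case using pCons.prems by (simp add: cinner_linear)
qed simp

lemma op_poly_self_adjoint: "self_adjoint H T \<Longrightarrow> self_adjoint H (op_poly H p T)"
  using op_poly_adjoint by (auto simp: self_adjoint_def)

end

lemma self_adjoint_Im:
  assumes "T \<in> bounded_ops H" "self_adjoint H T" "x \<in> carrier H"
  shows "Im (cinner H (T x) x) = 0"
proof -
  have "cinner H (T x) x = cnj (cinner H (T x) x)"
    using assms cinner_commute[of x "T x"] by (simp add: self_adjoint_def)
  then show ?thesis by (metis complex_cnj cancel_comm_monoid_add_class.diff_cancel
    complex.sel(2) add_self_div_2 cnj.simps(2) equal_neg_zero)
qed

text \<open>The Cauchy-Schwarz inequality for the positive form \<open>\<langle>S x, y\<rangle>\<close>: expand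
  \<open>0 \<le> \<langle>S z, z\<rangle>\<close> at \<open>z = x - S x / M\<close>.\<close>

lemma positive_op_norm_bound:
  assumes S: "S \<in> bounded_ops H" and sa: "self_adjoint H S"
    and pos: "\<And>x. x \<in> carrier H \<Longrightarrow> 0 \<le> Re (cinner H (S x) x)"
    and M: "M > 0" "\<And>x. x \<in> carrier H \<Longrightarrow> hnorm H (S x) \<le> M * hnorm H x"
    and x: "x \<in> carrier H"
  shows "(hnorm H (S x))\<^sup>2 \<le> M * Re (cinner H (S x) x)"
proof -
  let ?y = "S x" and ?c = "complex_of_real (1 / M)"
  let ?z = "x \<ominus> ?c \<odot> ?y"
  have y: "?y \<in> carrier H" "S ?y \<in> carrier H" using S x by auto
  have yy: "cinner H (S ?y) x = cinner H ?y ?y" using sa x y by (simp add: self_adjoint_def)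
  have "cinner H (S ?z) ?z = cinner H ?y x - of_real (2 / M) * cinner H ?y ?y
      + of_real (1 / M\<^sup>2) * cinner H (S ?y) ?y"
    using x y S by (simp add: op_linear cinner_linear yy algebra_simps power2_eq_square)
  then have "Re (cinner H (S ?z) ?z) = Re (cinner H ?y x) - 2 / M * (hnorm H ?y)\<^sup>2
      + 1 / M\<^sup>2 * Re (cinner H (S ?y) ?y)"
    by (simp add: cinner_self[OF y(1)])
  also have "\<dots> \<le> Re (cinner H ?y x) - 2 / M * (hnorm H ?y)\<^sup>2 + 1 / M\<^sup>2 * (M * (hnorm H ?y)\<^sup>2)"
  proof -
    have "Re (cinner H (S ?y) ?y) \<le> hnorm H (S ?y) * hnorm H ?y"
      using Re_cinner_le[OF y(2,1)] by linarith
    also have "\<dots> \<le> M * hnorm H ?y * hnorm H ?y"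
      using M(2)[OF y(1)] y by (intro mult_right_mono) auto
    finally show ?thesis
      using M(1) by (intro add_left_mono mult_left_mono) (auto simp: power2_eq_square mult.assoc)
  qed
  also have "\<dots> = Re (cinner H ?y x) - (hnorm H ?y)\<^sup>2 / M"
    using M(1) by (simp add: field_simps power2_eq_square)
  finally have "0 \<le> Re (cinner H ?y x) - (hnorm H ?y)\<^sup>2 / M"
    using pos[of ?z] x y by simp
  then show ?thesis using M(1) by (simp add: field_simps)
qed

end

section \<open>Spectral bounds for polynomials\<close>

text \<open>Take any complex zero \<open>z\<close>. If it is not real, the remainder of \<open>r\<close> modulo the real quadratic with
  zeros \<open>z\<close> and \<open>cnj z\<close> is a real polynomial of degree at most one that vanishes at \<open>z\<close>, hence zero.\<close>

lemma real_poly_factor: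
  fixes r :: "real poly"
  assumes "Polynomial.degree r > 0"
  obtains (linear) t q where "r = [:-t, 1:] * q"
  | (quadratic) a b q where "b \<noteq> 0" "r = [:a\<^sup>2 + b\<^sup>2, -2 * a, 1:] * q"
proof -
  let ?c = "map_poly complex_of_real"
  have "\<not> constant (poly (?c r))"
    using assms by (simp add: constant_degree degree_map_poly)
  then obtain z where z: "poly (?c r) z = 0"
    using fundamental_theorem_of_algebra by blast
  define ev where "ev p = poly (?c p) z" for p
  have ev_pCons: "ev (pCons a p) = of_real a + z * ev p" for a p
    by (simp add: ev_def map_poly_pCons)
  have ev_0: "ev 0 = 0" by (simp add: ev_def)
  have ev_add: "ev (p + q) = ev p + ev q" for p q
    by (induction p q rule: poly_induct2) (simp_all add: ev_pCons ev_0 algebra_simps)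
  have ev_smult: "ev (Polynomial.smult a q) = of_real a * ev q" for a q
    by (induction q) (simp_all add: ev_pCons ev_0 algebra_simps)
  have ev_mult: "ev (p * q) = ev p * ev q" for p q
    by (induction p) (simp_all add: ev_pCons ev_0 ev_add ev_smult algebra_simps)
  show ?thesis
  proof (cases "Im z = 0")
    case True
    have "ev p = of_real (poly p (Re z))" for p
      by (induction p) (use True in \<open>simp_all add: ev_pCons ev_0 complex_eq_iff\<close>)
    then have "poly r (Re z) = 0" using z by (metis ev_def of_real_eq_0_iff)
    then show ?thesis using linear by (auto simp: poly_eq_0_iff_dvd elim: dvdE)
  next
    case False
    let ?q = "[:(Re z)\<^sup>2 + (Im z)\<^sup>2, -2 * Re z, 1:]"
    have evq: "ev ?q = 0"
      by (simp add: ev_pCons ev_0 complex_eq_iff power2_eq_square algebra_simps)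
    have r: "r = ?q * (r div ?q) + r mod ?q" by (rule mult_div_mod_eq[symmetric])
    then have "ev (r mod ?q) = 0"
      using ev_add[of "?q * (r div ?q)" "r mod ?q"] ev_mult[of ?q] evq z ev_def by simp
    moreover have "Polynomial.degree (r mod ?q) < 2"
      using degree_mod_less'[of ?q r] by (cases "r mod ?q = 0") auto
    then obtain u v where uv: "r mod ?q = [:u, v:]"
    proof -
      assume a: "\<And>u v. r mod ?q = [:u, v:] \<Longrightarrow> thesis" and d: "Polynomial.degree (r mod ?q) < 2"
      have "r mod ?q = [:Polynomial.coeff (r mod ?q) 0, Polynomial.coeff (r mod ?q) 1:]"
        using d by (intro poly_eqI) (auto simp: coeff_pCons coeff_eq_0 split: nat.splits)
      then show thesis using a by blast
    qed
    ultimately have "of_real u + z * of_real v = 0" by (simp add: ev_pCons ev_0)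
    then have "v = 0" "u = 0" using False by (auto simp: complex_eq_iff)
    then have "r mod ?q = 0" using uv by simp
    then have "r = ?q * (r div ?q)" using r by (metis add_0_right)
    then show ?thesis using quadratic False by blast
  qed
qed

context chilbert_space
begin

text \<open>Factor \<open>r\<close>: a linear factor is bounded below because its zero lies outside the spectrum, a
  quadratic one \<open>(T - a)\<^sup>2 + b\<^sup>2\<close> because its form is at least \<open>b\<^sup>2\<close>.\<close>

lemma op_poly_bounded_below:
  assumes T: "T \<in> bounded_ops H" and sa: "self_adjoint H T" and "r \<noteq> 0"
    and "\<And>t. poly r t = 0 \<Longrightarrow> complex_of_real t \<notin> op_spectrum H T"
  shows "\<exists>d>0. \<forall>x\<in>carrier H. d * hnorm H x \<le> hnorm H (op_poly H r T x)"
  using assms(3-)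
proof (induction "Polynomial.degree r" arbitrary: r rule: less_induct)
  case less
  note [simp] = T
  have product: "\<exists>d>0. \<forall>x\<in>carrier H. d * hnorm H x \<le> hnorm H (op_poly H r T x)"
    if r: "r = f * q" and deg: "Polynomial.degree f > 0" and c: "c > 0"
      and f: "\<And>x. x \<in> carrier H \<Longrightarrow> c * hnorm H x \<le> hnorm H (op_poly H f T x)" for f q c
  proof -
    have q: "q \<noteq> 0" "f \<noteq> 0" using less.prems r by auto
    have "Polynomial.degree q < Polynomial.degree r" using r deg q by (simp add: degree_mult_eq)
    moreover have "complex_of_real t \<notin> op_spectrum H T" if "poly q t = 0" for t
      using less.prems(2) r that by simp
    ultimately obtain d where d: "d > 0"
      "\<And>x. x \<in> carrier H \<Longrightarrow> d * hnorm H x \<le> hnorm H (op_poly H q T x)"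
      using less.hyps q by blast
    have "c * d * hnorm H x \<le> hnorm H (op_poly H r T x)" if x: "x \<in> carrier H" for x
    proof -
      have "c * (d * hnorm H x) \<le> c * hnorm H (op_poly H q T x)"
        using d x c by (intro mult_left_mono) auto
      also have "\<dots> \<le> hnorm H (op_poly H r T x)"
        using f[of "op_poly H q T x"] x by (simp add: r op_poly_mult)
      finally show ?thesis by (simp add: mult.assoc)
    qed
    then show ?thesis using c d by (intro exI[of _ "c * d"]) auto
  qed
  show ?case
  proof (cases "Polynomial.degree r = 0")
    case True
    then obtain a where "r = [:a:]" by (rule degree_eq_zeroE)
    then show ?thesis using less.prems by (intro exI[of _ "\<bar>a\<bar>"]) auto
  next
    case False
    then have "Polynomial.degree r > 0" by simp
    then show ?thesis
    proof (cases r rule: real_poly_factor)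
      case (linear t q)
      have "complex_of_real t \<notin> op_spectrum H T" using less.prems(2) linear by simp
      then obtain d where d: "d > 0"
        "\<And>x. x \<in> carrier H \<Longrightarrow> d * hnorm H x \<le> hnorm H (op_diff H (op_scalar H (of_real t)) T x)"
        using op_invertible_below[of "op_diff H (op_scalar H (of_real t)) T"]
        by (auto simp: op_spectrum_def)
      have "hnorm H (op_diff H (op_scalar H (of_real t)) T x) = hnorm H (op_poly H [:-t, 1:] T x)"
        if x: "x \<in> carrier H" for x
      proof -
        have "op_diff H (op_scalar H (of_real t)) T x = (-1) \<odot> op_poly H [:-t, 1:] T x"
          using x by (intro cinner_ext) (auto simp: op_diff_def op_scalar_def cinner_linear)
        then show ?thesis using x by simp
      qed
      then show ?thesis using d by (intro product[OF linear]) auto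
    next
      case (quadratic a b q)
      let ?f = "[:a\<^sup>2 + b\<^sup>2, -2 * a, 1:]"
      have "b\<^sup>2 * hnorm H x \<le> hnorm H (op_poly H ?f T x)" if x: "x \<in> carrier H" for x
      proof -
        let ?y = "T x \<ominus> of_real a \<odot> x" and ?w = "op_poly H ?f T x"
        have y: "?y \<in> carrier H" and w: "?w \<in> carrier H" using x by auto
        have TT: "cinner H (T (T x)) x = cinner H (T x) (T x)"
          and T1: "cinner H x (T x) = cinner H (T x) x"
          using sa x by (auto simp: self_adjoint_def)
        have "cinner H ?w x = cinner H ?y ?y + of_real (b\<^sup>2) * cinner H x x"
          using x by (simp add: op_linear cinner_linear TT T1 algebra_simps power2_eq_square)
        then have "Re (cinner H ?w x) = (hnorm H ?y)\<^sup>2 + b\<^sup>2 * (hnorm H x)\<^sup>2"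
          by (simp add: cinner_self[OF y] cinner_self[OF x] del: of_real_power of_real_mult
              flip: of_real_mult of_real_add)
        then have "b\<^sup>2 * (hnorm H x)\<^sup>2 \<le> hnorm H ?w * hnorm H x"
          using Re_cinner_le[OF w x] by (smt (verit) zero_le_power2)
        then show ?thesis
          using w x hnorm_ge0[OF x]
          by (cases "hnorm H x = 0") (auto simp: power2_eq_square mult_le_cancel_right simp flip: mult.assoc)
      qed
      then show ?thesis using quadratic(1) by (intro product[OF quadratic(2)]) auto
    qed
  qed
qed

end

abbreviation (input) real_spectrum :: "'b chilbert \<Rightarrow> ('b \<Rightarrow> 'b) \<Rightarrow> real set" where
  "real_spectrum H T \<equiv> {t. complex_of_real t \<in> op_spectrum H T}"

context chilbert_space
begin

text \<open>Let \<open>s\<close> be the largest number with \<open>s \<le> q(T)\<close> and suppose \<open>s < 0\<close>. Then \<open>r = q - s\<close> has no zero in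
  the spectrum, so \<open>r(T)\<close> is bounded below; being positive, it is then bounded below as a form, and
  \<open>s\<close> was not the largest. A constant \<open>q\<close> is excluded because \<open>r\<close> could then be the zero polynomial.\<close>

lemma op_poly_nonneg_of_degree:
  assumes T: "T \<in> bounded_ops H" and sa: "self_adjoint H T" and deg: "Polynomial.degree q > 0"
    and q: "\<And>t. t \<in> real_spectrum H T \<Longrightarrow> 0 \<le> poly q t" and x: "x \<in> carrier H"
  shows "0 \<le> Re (cinner H (op_poly H q T x) x)"
proof (rule ccontr)
  assume neg: "\<not> ?thesis"
  let ?Q = "op_poly H q T"
  have Q: "?Q \<in> bounded_ops H" using T by simp
  obtain N where N: "\<And>x. x \<in> carrier H \<Longrightarrow> - N * (hnorm H x)\<^sup>2 \<le> Re (cinner H (?Q x) x)"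
    using op_form_bound[OF Q] by blast
  define C where "C = {c. \<forall>x\<in>carrier H. c * (hnorm H x)\<^sup>2 \<le> Re (cinner H (?Q x) x)}"
  have ne: "- N \<in> C" using N by (simp add: C_def)
  have C_neg: "c < 0" if "c \<in> C" for c
  proof (rule ccontr)
    assume "\<not> c < 0"
    then have "0 \<le> c * (hnorm H x)\<^sup>2" by simp
    also have "\<dots> \<le> Re (cinner H (?Q x) x)" using that x by (simp add: C_def)
    finally show False using neg by simp
  qed
  then have bdd: "bdd_above C" by (meson bdd_aboveI less_imp_le)
  define s where "s = Sup C"
  have sC: "s \<in> C"
    unfolding C_def
  proof (intro CollectI ballI)
    fix y assume y: "y \<in> carrier H"
    show "s * (hnorm H y)\<^sup>2 \<le> Re (cinner H (?Q y) y)"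
    proof (cases "hnorm H y = 0")
      case True
      then show ?thesis using y Q by simp
    next
      case False
      then have pos: "(hnorm H y)\<^sup>2 > 0" by simp
      have "s \<le> Re (cinner H (?Q y) y) / (hnorm H y)\<^sup>2"
        unfolding s_def
      proof (rule cSup_least)
        show "C \<noteq> {}" using ne by blast
      qed (use y pos in \<open>auto simp: C_def pos_le_divide_eq\<close>)
      then show ?thesis using pos by (simp add: pos_le_divide_eq)
    qed
  qed
  define r where "r = q - [:s:]"
  have "r \<noteq> 0" using deg by (auto simp: r_def)
  moreover have "complex_of_real t \<notin> op_spectrum H T" if "poly r t = 0" for t
    using q[of t] that C_neg[OF sC] by (auto simp: r_def)
  ultimately obtain d where d: "d > 0"
    "\<And>x. x \<in> carrier H \<Longrightarrow> d * hnorm H x \<le> hnorm H (op_poly H r T x)"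
    using op_poly_bounded_below[OF T sa] by blast
  let ?R = "op_poly H r T"
  have R: "?R \<in> bounded_ops H" "self_adjoint H ?R" using T sa by (auto intro: op_poly_self_adjoint)
  have form: "Re (cinner H (?R y) y) = Re (cinner H (?Q y) y) - s * (hnorm H y)\<^sup>2"
    if y: "y \<in> carrier H" for y
    using y T Q by (simp add: r_def op_poly_diff cinner_linear hnorm_square)
  have pos: "0 \<le> Re (cinner H (?R y) y)" if "y \<in> carrier H" for y
    using sC that by (simp add: form C_def)
  obtain M where M: "M > 0" "\<And>x. x \<in> carrier H \<Longrightarrow> hnorm H (?R x) \<le> M * hnorm H x"
    using op_bound[OF R(1)] by blast
  have "(s + d\<^sup>2 / M) * (hnorm H y)\<^sup>2 \<le> Re (cinner H (?Q y) y)" if y: "y \<in> carrier H" for y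
  proof -
    have "(d * hnorm H y)\<^sup>2 \<le> (hnorm H (?R y))\<^sup>2"
      using d y by (intro power_mono) auto
    also have "\<dots> \<le> M * Re (cinner H (?R y) y)"
      using positive_op_norm_bound[OF R pos M y] .
    finally have "d\<^sup>2 / M * (hnorm H y)\<^sup>2 \<le> Re (cinner H (?R y) y)"
      using M(1) by (simp add: power_mult_distrib field_simps)
    then show ?thesis using y by (simp add: form algebra_simps)
  qed
  then have "s + d\<^sup>2 / M \<in> C" by (simp add: C_def)
  then have "s + d\<^sup>2 / M \<le> s" unfolding s_def using bdd by (rule cSup_upper)
  then show False using d(1) M(1) by (simp add: divide_le_0_iff)
qed

text \<open>The spectrum is empty only on the zero space, because then even \<open>-1 - T\<^sup>2\<close> is positive.\<close>

lemma op_poly_nonneg: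
  assumes T: "T \<in> bounded_ops H" and sa: "self_adjoint H T"
    and q: "\<And>t. t \<in> real_spectrum H T \<Longrightarrow> 0 \<le> poly q t" and x: "x \<in> carrier H"
  shows "0 \<le> Re (cinner H (op_poly H q T x) x)"
proof (cases "Polynomial.degree q = 0")
  case False
  then show ?thesis using op_poly_nonneg_of_degree[OF T sa _ q x] by simp
next
  case True
  then obtain c where c: "q = [:c:]" by (rule degree_eq_zeroE)
  show ?thesis
  proof (cases "real_spectrum H T = {}")
    case False
    then have "0 \<le> c" using q c by auto
    then show ?thesis using x T by (simp add: c cinner_linear cinner_self)
  next
    case True
    have "0 \<le> Re (cinner H (op_poly H [:-1, 0, -1:] T x) x)"
      using True by (intro op_poly_nonneg_of_degree[OF T sa _ _ x]) auto
    also have "\<dots> = - (hnorm H x)\<^sup>2 - (hnorm H (T x))\<^sup>2"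
      using x T sa by (simp add: cinner_linear op_linear hnorm_square self_adjoint_def)
    finally have "(hnorm H x)\<^sup>2 \<le> 0" using zero_le_power2[of "hnorm H (T x)"] by linarith
    then have "x = \<zero>" using x by simp
    then show ?thesis using T by simp
  qed
qed

text \<open>Positivity of \<open>e\<^sup>2 - p\<^sup>2\<close> at \<open>T\<close>.\<close>

lemma op_poly_norm_le:
  assumes T: "T \<in> bounded_ops H" and sa: "self_adjoint H T"
    and p: "\<And>t. t \<in> real_spectrum H T \<Longrightarrow> \<bar>poly p t\<bar> \<le> e" and e: "0 \<le> e" and x: "x \<in> carrier H"
  shows "hnorm H (op_poly H p T x) \<le> e * hnorm H x"
proof -
  let ?p = "op_poly H p T"
  have px: "?p x \<in> carrier H" using T x by simp
  have "0 \<le> poly ([:e\<^sup>2:] - p * p) t" if "t \<in> real_spectrum H T" for t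
    using power_mono[OF p[OF that], of 2] by (simp add: power2_eq_square)
  then have "0 \<le> Re (cinner H (op_poly H ([:e\<^sup>2:] - p * p) T x) x)"
    by (rule op_poly_nonneg[OF T sa _ x])
  also have "\<dots> = e\<^sup>2 * (hnorm H x)\<^sup>2 - (hnorm H (?p x))\<^sup>2"
    using T x px op_poly_adjoint[OF T sa px x, of p]
    by (simp add: op_poly_diff op_poly_mult cinner_diff_left cinner_smult_left cinner_self del: of_real_power flip: of_real_mult)
  finally have "(hnorm H (?p x))\<^sup>2 \<le> (e * hnorm H x)\<^sup>2" by (simp add: power_mult_distrib)
  then show ?thesis by (rule power2_le_imp_le) (use e x in auto)
qed

text \<open>Outside \<open>[m, M]\<close> the operator \<open>z - T\<close> is coercive: in the direction of \<open>\<plusminus>\<i>\<close> for nonreal \<open>z\<close>, and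
  of \<open>\<plusminus>1\<close> for real \<open>z\<close>.\<close>

lemma op_spectrum_subset:
  assumes T: "T \<in> bounded_ops H" and sa: "self_adjoint H T"
    and form: "\<And>x. x \<in> carrier H \<Longrightarrow> m * (hnorm H x)\<^sup>2 \<le> Re (cinner H (T x) x)
      \<and> Re (cinner H (T x) x) \<le> M * (hnorm H x)\<^sup>2"
  shows "op_spectrum H T \<subseteq> complex_of_real ` {m..M}"
proof
  fix z assume z: "z \<in> op_spectrum H T"
  let ?S = "op_diff H (op_scalar H z) T"
  have S: "?S \<in> bounded_ops H" using T by simp
  have Sx: "cinner H (?S x) x = z * of_real ((hnorm H x)\<^sup>2) - of_real (Re (cinner H (T x) x))"
    if x: "x \<in> carrier H" for x
  proof -
    have "cinner H (T x) x = of_real (Re (cinner H (T x) x))"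
      using self_adjoint_Im[OF T sa x] by (simp add: complex_eq_iff)
    moreover have "cinner H (?S x) x = z * cinner H x x - cinner H (T x) x"
      using x T by (simp add: op_diff_def op_scalar_def cinner_linear)
    ultimately show ?thesis using x by (simp add: cinner_self)
  qed
  have no: False if "cmod c = 1" "d > 0"
    "\<And>x. x \<in> carrier H \<Longrightarrow> d * (hnorm H x)\<^sup>2 \<le> Re (c * cinner H (?S x) x)" for c d
    using Lax_Milgram(1)[OF S that] z by (simp add: op_spectrum_def)
  have "Im z = 0"
  proof (rule ccontr)
    assume "Im z \<noteq> 0"
    then consider "Im z > 0" | "Im z < 0" by linarith
    then show False
    proof cases
      case 1
      then show False by (intro no[of "-\<i>" "Im z"]) (auto simp: Sx)
    next
      case 2
      then show False by (intro no[of "\<i>" "- Im z"]) (auto simp: Sx)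
    qed
  qed
  moreover have "Re z \<le> M"
  proof (rule ccontr)
    assume "\<not> Re z \<le> M"
    then show False
      using form by (intro no[of 1 "Re z - M"]) (auto simp: Sx algebra_simps)
  qed
  moreover have "m \<le> Re z"
  proof (rule ccontr)
    assume "\<not> m \<le> Re z"
    then show False
      using form by (intro no[of "-1" "m - Re z"]) (auto simp: Sx algebra_simps)
  qed
  ultimately show "z \<in> complex_of_real ` {m..M}"
    by (intro image_eqI[of _ _ "Re z"]) (auto simp: complex_eq_iff)
qed

end

section \<open>The continuous functional calculus\<close>

lemma Weierstrass_real_poly:
  fixes g :: "real \<Rightarrow> real"
  assumes "continuous_on {m..M} g" "e > 0"
  obtains p where "\<And>t. t \<in> {m..M} \<Longrightarrow> \<bar>poly p t - g t\<bar> < e"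
proof -
  obtain f where f: "real_polynomial_function f" "\<And>t. t \<in> {m..M} \<Longrightarrow> \<bar>g t - f t\<bar> < e"
    using Stone_Weierstrass_real_polynomial_function[OF _ assms] by blast
  obtain a n where "f = (\<lambda>x. \<Sum>i\<le>n. a i * x ^ i)"
    using f(1) real_polynomial_function_iff_sum by blast
  then have "poly (\<Sum>i\<le>n. Polynomial.monom (a i) i) t = f t" for t
    by (simp add: poly_sum poly_monom)
  then show ?thesis using that f(2) by (metis abs_minus_commute)
qed

context chilbert_space
begin

lemma op_norm_bounds:
  assumes D: "D \<in> bounded_ops H"
  shows "0 \<le> op_norm H D" "x \<in> carrier H \<Longrightarrow> hnorm H (D x) \<le> op_norm H D * hnorm H x"
    and "\<lbrakk>0 \<le> e; \<And>x. x \<in> carrier H \<Longrightarrow> hnorm H (D x) \<le> e * hnorm H x\<rbrakk> \<Longrightarrow> op_norm H D \<le> e"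
proof -
  let ?B = "{x \<in> carrier H. hnorm H x \<le> 1}"
  obtain M where M: "M > 0" "\<And>x. x \<in> carrier H \<Longrightarrow> hnorm H (D x) \<le> M * hnorm H x"
    using op_bound[OF D] by blast
  have le: "hnorm H (D x) \<le> e"
    if "x \<in> ?B" "0 \<le> e" "\<And>x. x \<in> carrier H \<Longrightarrow> hnorm H (D x) \<le> e * hnorm H x" for x e
    using that mult_left_mono[of "hnorm H x" 1 e] by fastforce
  have bdd: "bdd_above ((\<lambda>x. hnorm H (D x)) ` ?B)"
    using le[OF _ less_imp_le[OF M(1)] M(2)] by (intro bdd_aboveI2[of _ _ M]) auto
  have upper: "hnorm H (D x) \<le> op_norm H D" if "x \<in> ?B" for x
    unfolding op_norm_def using that bdd by (rule cSUP_upper)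
  have zero: "\<zero> \<in> ?B" by simp
  show "0 \<le> op_norm H D" using upper[OF zero] D by simp
  show "hnorm H (D x) \<le> op_norm H D * hnorm H x" if x: "x \<in> carrier H"
  proof (cases "x = \<zero>")
    case True
    then show ?thesis using D by simp
  next
    case False
    then have pos: "hnorm H x > 0" using x by (simp add: less_le)
    let ?c = "complex_of_real (1 / hnorm H x)"
    have "?c \<odot> x \<in> ?B" using x pos by (simp add: norm_divide)
    from upper[OF this] have "1 / hnorm H x * hnorm H (D x) \<le> op_norm H D"
      using D x pos by (simp add: op_linear norm_divide)
    then show ?thesis using pos by (simp add: field_simps)
  qed
  show "op_norm H D \<le> e"
    if "0 \<le> e" "\<And>x. x \<in> carrier H \<Longrightarrow> hnorm H (D x) \<le> e * hnorm H x"
    unfolding op_norm_def using zero le[OF _ that] by (intro cSUP_least) auto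
qed

text \<open>The limit of \<open>p\<^sub>n(T)\<close> for one sequence \<open>p\<^sub>n \<rightarrow> g\<close> exists by completeness; the
  polynomial norm bound on the spectrum makes it independent of the sequence.\<close>

lemma cfc_approx:
  assumes T: "T \<in> bounded_ops H" and sa: "self_adjoint H T"
    and form: "\<And>x. x \<in> carrier H \<Longrightarrow> m * (hnorm H x)\<^sup>2 \<le> Re (cinner H (T x) x)
      \<and> Re (cinner H (T x) x) \<le> M * (hnorm H x)\<^sup>2"
    and g: "continuous_on {m..M} g"
  shows "cfc H g T \<in> bounded_ops H"
    and "\<lbrakk>\<And>t. t \<in> {m..M} \<Longrightarrow> \<bar>poly q t - g t\<bar> \<le> e; 0 \<le> e; x \<in> carrier H\<rbrakk>
      \<Longrightarrow> hnorm H (op_poly H q T x \<ominus> cfc H g T x) \<le> e * hnorm H x"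
proof -
  let ?\<sigma> = "real_spectrum H T"
  have \<sigma>: "?\<sigma> \<subseteq> {m..M}" using op_spectrum_subset[OF T sa form] by auto
  define \<epsilon> where "\<epsilon> n = inverse (real (Suc n))" for n
  have \<epsilon>: "\<epsilon> n > 0" "\<epsilon> \<longlonglongrightarrow> 0" for n
    unfolding \<epsilon>_def using LIMSEQ_inverse_real_of_nat by auto
  have "\<exists>p. \<forall>t\<in>{m..M}. \<bar>poly p t - g t\<bar> < \<epsilon> n" for n
    using Weierstrass_real_poly[OF g \<epsilon>(1)] by metis
  then obtain p where p: "\<And>n t. t \<in> {m..M} \<Longrightarrow> \<bar>poly (p n) t - g t\<bar> < \<epsilon> n" by metis
  have close: "hnorm H (op_poly H q T x \<ominus> op_poly H (p n) T x) \<le> (e + \<epsilon> n) * hnorm H x"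
    if q: "\<And>t. t \<in> ?\<sigma> \<Longrightarrow> \<bar>poly q t - g t\<bar> \<le> e" "0 \<le> e" and x: "x \<in> carrier H" for q e n x
  proof -
    have "\<bar>poly (q - p n) t\<bar> \<le> e + \<epsilon> n" if t: "t \<in> ?\<sigma>" for t
      using q(1)[OF t] p[of t n] \<sigma> t by fastforce
    then have "hnorm H (op_poly H (q - p n) T x) \<le> (e + \<epsilon> n) * hnorm H x"
      using q x \<epsilon>(1)[of n] by (intro op_poly_norm_le[OF T sa]) auto
    then show ?thesis using T x by (simp add: op_poly_diff)
  qed
  let ?u = "\<lambda>x n. op_poly H (p n) T x"
  have "\<exists>y\<in>carrier H. vlim (?u x) y" if x: "x \<in> carrier H" for x
    unfolding vlim_def
  proof (rule complete)
    show "?u x n \<in> carrier H" for n using T x by simp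
    show "\<forall>e>0. \<exists>N. \<forall>k\<ge>N. \<forall>n\<ge>N. hnorm H (?u x k \<ominus> ?u x n) < e"
    proof (intro allI impI)
      fix e :: real assume e: "e > 0"
      have "(\<lambda>n. \<epsilon> n * hnorm H x) \<longlonglongrightarrow> 0" using tendsto_mult_left_zero[OF \<epsilon>(2)] by simp
      then have "\<forall>\<^sub>F n in sequentially. \<epsilon> n * hnorm H x < e / 2"
        using e by (intro order_tendstoD(2)[of _ 0]) auto
      then obtain N where N: "\<And>n. n \<ge> N \<Longrightarrow> \<epsilon> n * hnorm H x < e / 2"
        by (auto simp: eventually_sequentially)
      have "hnorm H (?u x k \<ominus> ?u x n) < e" if "k \<ge> N" "n \<ge> N" for k n
      proof -
        have "hnorm H (?u x k \<ominus> ?u x n) \<le> (\<epsilon> k + \<epsilon> n) * hnorm H x"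
          using p \<sigma> \<epsilon>(1) x by (intro close) (auto intro!: less_imp_le)
        then show ?thesis using N[OF that(1)] N[OF that(2)] by (simp add: algebra_simps)
      qed
      then show "\<exists>N. \<forall>k\<ge>N. \<forall>n\<ge>N. hnorm H (?u x k \<ominus> ?u x n) < e" by blast
    qed
  qed
  then obtain L where L: "\<And>x. x \<in> carrier H \<Longrightarrow> L x \<in> carrier H"
    "\<And>x. x \<in> carrier H \<Longrightarrow> vlim (?u x) (L x)" by metis
  define S where "S = (\<lambda>x\<in>carrier H. L x)"
  have S_cl: "S x \<in> carrier H" and S_lim: "vlim (?u x) (S x)" if "x \<in> carrier H" for x
    using L that by (auto simp: S_def)
  have approx: "hnorm H (op_poly H q T x \<ominus> S x) \<le> e * hnorm H x"
    if q: "\<And>t. t \<in> ?\<sigma> \<Longrightarrow> \<bar>poly q t - g t\<bar> \<le> e" "0 \<le> e" and x: "x \<in> carrier H" for q e x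
  proof -
    have "hnorm H (op_poly H q T x \<ominus> S x) \<le> (e + \<epsilon> n) * hnorm H x + hnorm H (?u x n \<ominus> S x)" for n
      using hnorm_diff_triangle[of "op_poly H q T x" "?u x n" "S x"] close[OF q x, of n] S_cl x T by simp
    moreover have "(\<lambda>n. (e + \<epsilon> n) * hnorm H x + hnorm H (?u x n \<ominus> S x)) \<longlonglongrightarrow> (e + 0) * hnorm H x + 0"
      using S_lim[OF x] \<epsilon>(2) unfolding vlim_def by (intro tendsto_intros) auto
    ultimately show ?thesis by (intro LIMSEQ_le_const) auto
  qed
  have pS: "hnorm H (?u x n \<ominus> S x) \<le> \<epsilon> n * hnorm H x" if "x \<in> carrier H" for x n
    using p \<sigma> \<epsilon>(1) that by (intro approx) (auto intro!: less_imp_le)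
  obtain N where N: "\<And>x. x \<in> carrier H \<Longrightarrow> hnorm H (?u x 0) \<le> N * hnorm H x"
    using op_bound[of "op_poly H (p 0) T"] T by auto
  have S: "S \<in> bounded_ops H"
  proof (rule bounded_opsI[where M = "N + \<epsilon> 0"])
    fix x y assume xy: "x \<in> carrier H" "y \<in> carrier H"
    have "vlim (?u (x \<oplus> y)) (S x \<oplus> S y)"
      using vlim_add[OF _ _ _ _ S_lim[OF xy(1)] S_lim[OF xy(2)]] xy T S_cl
      by (simp add: op_linear[OF op_poly_bounded])
    then show "S (x \<oplus> y) = S x \<oplus> S y"
      using xy T S_cl S_lim[of "x \<oplus> y"] by (intro vlim_unique[of "?u (x \<oplus> y)"]) auto
  next
    fix c x assume x: "x \<in> carrier H"
    have "vlim (?u (c \<odot> x)) (c \<odot> S x)"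
      using vlim_smult[OF _ _ S_lim[OF x], of c] x T S_cl
      by (simp add: op_linear[OF op_poly_bounded])
    then show "S (c \<odot> x) = c \<odot> S x"
      using x T S_cl S_lim[of "c \<odot> x"] by (intro vlim_unique[of "?u (c \<odot> x)"]) auto
  next
    fix x assume x: "x \<in> carrier H"
    have "hnorm H (S x) \<le> hnorm H (S x \<ominus> ?u x 0) + hnorm H (?u x 0)"
      using x S_cl T by (intro hnorm_diff_le) auto
    then show "hnorm H (S x) \<le> (N + \<epsilon> 0) * hnorm H x"
      using pS[OF x, of 0] N[OF x] hnorm_diff_sym[of "S x" "?u x 0"] x S_cl T
      by (simp add: algebra_simps)
  qed (use S_cl in \<open>auto simp: S_def\<close>)
  have "cfc H g T = S"
    unfolding cfc_def
  proof (rule the_equality)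
    have "uniform_limit ?\<sigma> (\<lambda>n. poly (p n)) g sequentially"
    proof (rule uniform_limitI)
      fix e :: real assume "e > 0"
      then have "\<forall>\<^sub>F n in sequentially. \<epsilon> n < e" using \<epsilon>(2) by (intro order_tendstoD(2)) auto
      then show "\<forall>\<^sub>F n in sequentially. \<forall>t\<in>?\<sigma>. dist (poly (p n) t) (g t) < e"
      proof eventually_elim
        case (elim n)
        show ?case
        proof
          fix t assume "t \<in> ?\<sigma>"
          then have "t \<in> {m..M}" using \<sigma> by blast
          from p[OF this, of n] show "dist (poly (p n) t) (g t) < e"
            using elim by (simp add: dist_real_def)
        qed
      qed
    qed
    moreover have "(\<lambda>n. op_norm H (op_diff H (op_poly H (p n) T) S)) \<longlonglongrightarrow> 0"
    proof (rule tendsto_sandwich[OF _ _ tendsto_const \<epsilon>(2)])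
      have D: "op_diff H (op_poly H (p n) T) S \<in> bounded_ops H" for n using T S by simp
      show "\<forall>\<^sub>F n in sequentially. 0 \<le> op_norm H (op_diff H (op_poly H (p n) T) S)"
        using op_norm_bounds(1)[OF D] by simp
      have "op_norm H (op_diff H (op_poly H (p n) T) S) \<le> \<epsilon> n" for n
        using pS less_imp_le[OF \<epsilon>(1)] by (intro op_norm_bounds(3)[OF D]) (auto simp: op_diff_def)
      then show "\<forall>\<^sub>F n in sequentially. op_norm H (op_diff H (op_poly H (p n) T) S) \<le> \<epsilon> n" by simp
    qed
    ultimately show "S \<in> bounded_ops H \<and> (\<exists>p. uniform_limit ?\<sigma> (\<lambda>n. poly (p n)) g sequentially \<and>
        (\<lambda>n. op_norm H (op_diff H (op_poly H (p n) T) S)) \<longlonglongrightarrow> 0)"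
      using S by blast
  next
    fix S' assume "S' \<in> bounded_ops H \<and> (\<exists>p. uniform_limit ?\<sigma> (\<lambda>n. poly (p n)) g sequentially \<and>
        (\<lambda>n. op_norm H (op_diff H (op_poly H (p n) T) S')) \<longlonglongrightarrow> 0)"
    then obtain p' where S': "S' \<in> bounded_ops H"
      and unif: "uniform_limit ?\<sigma> (\<lambda>n. poly (p' n)) g sequentially"
      and lim: "(\<lambda>n. op_norm H (op_diff H (op_poly H (p' n) T) S')) \<longlonglongrightarrow> 0" by blast
    show "S' = S"
    proof (rule bounded_ops_ext[OF S' S])
      fix x assume x: "x \<in> carrier H"
      have "vlim (\<lambda>n. op_poly H (p' n) T x) (S' x)"
      proof (rule vlimI)
        show "hnorm H (op_poly H (p' n) T x \<ominus> S' x)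
            \<le> op_norm H (op_diff H (op_poly H (p' n) T) S') * hnorm H x" for n
          using op_norm_bounds(2)[OF op_diff_bounded[OF op_poly_bounded[OF T] S'] x, of "p' n"] x
          by (simp add: op_diff_def)
        show "(\<lambda>n. op_norm H (op_diff H (op_poly H (p' n) T) S') * hnorm H x) \<longlonglongrightarrow> 0"
          using tendsto_mult_left_zero[OF lim] by simp
      qed (use T S' x in auto)
      moreover have "vlim (\<lambda>n. op_poly H (p' n) T x) (S x)"
        unfolding vlim_def
      proof (rule tendstoI)
        fix e :: real assume e: "e > 0"
        define e' where "e' = e / (hnorm H x + 1)"
        have e': "e' > 0" "e' * hnorm H x < e"
          using e hnorm_ge0[OF x] by (auto simp: e'_def field_simps add_nonneg_pos)
        have "\<forall>\<^sub>F n in sequentially. \<forall>t\<in>?\<sigma>. dist (poly (p' n) t) (g t) < e'"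
          using uniform_limitD[OF unif e'(1)] .
        then show "\<forall>\<^sub>F n in sequentially. dist (hnorm H (op_poly H (p' n) T x \<ominus> S x)) 0 < e"
        proof eventually_elim
          case (elim n)
          have "hnorm H (op_poly H (p' n) T x \<ominus> S x) \<le> e' * hnorm H x"
            using elim e'(1) x by (intro approx) (auto simp: dist_real_def less_imp_le)
          then show ?case using e'(2) x T S_cl by (simp add: dist_real_def)
        qed
      qed
      ultimately show "S' x = S x"
        using T S' x S_cl by (intro vlim_unique[of "\<lambda>n. op_poly H (p' n) T x"]) auto
    qed
  qed
  then show "cfc H g T \<in> bounded_ops H" using S by simp
  show "hnorm H (op_poly H q T x \<ominus> cfc H g T x) \<le> e * hnorm H x"
    if "\<And>t. t \<in> {m..M} \<Longrightarrow> \<bar>poly q t - g t\<bar> \<le> e" "0 \<le> e" "x \<in> carrier H"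
    using approx[of q e x] that subsetD[OF \<sigma>] unfolding \<open>cfc H g T = S\<close> by blast
qed

end

section \<open>Closed subspaces, compressions and intertwining maps\<close>

text \<open>Subtraction is written \<open>x \<oplus> (-1) \<odot> y\<close>: the inverse of an abelian group record is chosen from
  its carrier, so \<open>\<ominus>\<close> changes with the carrier while \<open>\<oplus>\<close> and \<open>\<odot>\<close> are inherited.\<close>

lemma chilbert_spaceI:
  fixes H :: "'a chilbert" (structure)
  assumes add_closed: "\<And>x y. \<lbrakk>x \<in> carrier H; y \<in> carrier H\<rbrakk> \<Longrightarrow> x \<oplus> y \<in> carrier H"
    and zero_closed: "\<zero> \<in> carrier H"
    and smult_closed: "\<And>c x. x \<in> carrier H \<Longrightarrow> c \<odot> x \<in> carrier H"
    and "\<And>x y z. \<lbrakk>x \<in> carrier H; y \<in> carrier H; z \<in> carrier H\<rbrakk> \<Longrightarrow> (x \<oplus> y) \<oplus> z = x \<oplus> (y \<oplus> z)"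
    and comm: "\<And>x y. \<lbrakk>x \<in> carrier H; y \<in> carrier H\<rbrakk> \<Longrightarrow> x \<oplus> y = y \<oplus> x"
    and "\<And>x. x \<in> carrier H \<Longrightarrow> \<zero> \<oplus> x = x"
    and neg: "\<And>x. x \<in> carrier H \<Longrightarrow> x \<oplus> (-1) \<odot> x = \<zero>"
    and module_laws: "\<And>c d x. x \<in> carrier H \<Longrightarrow> (c + d) \<odot> x = c \<odot> x \<oplus> d \<odot> x"
      "\<And>c x y. \<lbrakk>x \<in> carrier H; y \<in> carrier H\<rbrakk> \<Longrightarrow> c \<odot> (x \<oplus> y) = c \<odot> x \<oplus> c \<odot> y"
      "\<And>c d x. x \<in> carrier H \<Longrightarrow> (c * d) \<odot> x = c \<odot> (d \<odot> x)"
      "\<And>x. x \<in> carrier H \<Longrightarrow> 1 \<odot> x = x"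
    and "\<And>x y z. \<lbrakk>x \<in> carrier H; y \<in> carrier H; z \<in> carrier H\<rbrakk>
        \<Longrightarrow> cinner H (x \<oplus> y) z = cinner H x z + cinner H y z"
    and "\<And>c x y. \<lbrakk>x \<in> carrier H; y \<in> carrier H\<rbrakk> \<Longrightarrow> cinner H (c \<odot> x) y = c * cinner H x y"
    and "\<And>x y. \<lbrakk>x \<in> carrier H; y \<in> carrier H\<rbrakk> \<Longrightarrow> cinner H x y = cnj (cinner H y x)"
    and "\<And>x. x \<in> carrier H \<Longrightarrow> cinner H x x \<in> \<real>\<^sub>\<ge>\<^sub>0"
    and "\<And>x. \<lbrakk>x \<in> carrier H; cinner H x x = 0\<rbrakk> \<Longrightarrow> x = \<zero>"
    and complete: "\<And>u. \<lbrakk>\<And>n. u n \<in> carrier H;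
        \<And>e. e > 0 \<Longrightarrow> \<exists>N::nat. \<forall>m\<ge>N. \<forall>n\<ge>N. hnorm H (u m \<oplus> (-1) \<odot> u n) < e\<rbrakk>
        \<Longrightarrow> \<exists>x\<in>carrier H. (\<lambda>n. hnorm H (u n \<oplus> (-1) \<odot> x)) \<longlonglongrightarrow> 0"
  shows "chilbert_space H"
proof -
  have "abelian_group H"
  proof (rule abelian_groupI)
    fix x assume "x \<in> carrier H"
    then show "\<exists>y\<in>carrier H. y \<oplus> x = \<zero>"
      using neg comm smult_closed by (intro bexI[of _ "(-1) \<odot> x"]) auto
  qed (fact assms)+
  then have mod: "module (ring_of_type_algebra :: complex ring) H"
    by (intro moduleI cring_from_type_algebra)
      (simp_all add: ring_of_type_algebra_def smult_closed module_laws)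
  interpret M: abelian_group H by fact
  have minus: "x \<ominus> y = x \<oplus> (-1) \<odot> y" if "x \<in> carrier H" "y \<in> carrier H" for x y
    using M.minus_equality[of "(-1) \<odot> y" y] neg[OF that(2)] comm[of "(-1) \<odot> y" y] smult_closed that
    by (simp add: a_minus_def)
  show ?thesis
  proof (intro chilbert_space.intro mod chilbert_space_axioms.intro)
    fix u :: "nat \<Rightarrow> 'a"
    assume u: "\<And>n. u n \<in> carrier H"
      and cau: "\<forall>e>0. \<exists>N. \<forall>m\<ge>N. \<forall>n\<ge>N. hnorm H (u m \<ominus> u n) < e"
    have "\<exists>x\<in>carrier H. (\<lambda>n. hnorm H (u n \<oplus> (-1) \<odot> x)) \<longlonglongrightarrow> 0"
      using u cau by (intro complete) (auto simp: minus[OF u u])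
    then show "\<exists>x\<in>carrier H. (\<lambda>n. hnorm H (u n \<ominus> x)) \<longlonglongrightarrow> 0"
      using u minus by auto
  qed (fact assms)+
qed

context chilbert_space
begin

lemma orth_projD:
  assumes P: "orth_proj H P"
  shows "P \<in> bounded_ops H" "self_adjoint H P" "x \<in> carrier H \<Longrightarrow> P (P x) = P x"
    and "y \<in> P ` carrier H \<Longrightarrow> y \<in> carrier H" "y \<in> P ` carrier H \<Longrightarrow> P y = y"
proof -
  show b: "P \<in> bounded_ops H" and "self_adjoint H P" using P by (auto simp: orth_proj_def)
  show PP: "P (P x) = P x" if "x \<in> carrier H" for x
    using P that by (metis compose_eq orth_proj_def)
  show "y \<in> P ` carrier H \<Longrightarrow> y \<in> carrier H" "y \<in> P ` carrier H \<Longrightarrow> P y = y"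
    using b by (auto simp: PP)
qed

lemma projection_norm_le:
  assumes x: "x \<in> carrier H" and p: "p \<in> carrier H" and pp: "cinner H p p = cinner H x p"
  shows "hnorm H p \<le> hnorm H x"
proof -
  have "(hnorm H p)\<^sup>2 \<le> hnorm H x * hnorm H p"
    using Re_cinner_le[OF x p] p pp by (simp add: hnorm_square)
  then show ?thesis
    using hnorm_ge0[OF p] hnorm_ge0[OF x] by (cases "hnorm H p = 0") (auto simp: power2_eq_square)
qed

lemma orth_proj_norm_le:
  assumes P: "orth_proj H P" and x: "x \<in> carrier H"
  shows "hnorm H (P x) \<le> hnorm H x"
  using orth_projD(1-3)[OF P] x by (intro projection_norm_le) (simp_all add: self_adjoint_def)

text \<open>Boundedness follows from the other properties: \<open>|P x|\<^sup>2 = \<langle>x, P x\<rangle> \<le> |x| |P x|\<close>.\<close>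

lemma orth_projI:
  assumes cl: "\<And>x. x \<in> carrier H \<Longrightarrow> P x \<in> carrier H"
    and ext: "\<And>x. x \<notin> carrier H \<Longrightarrow> P x = undefined"
    and "\<And>x y. \<lbrakk>x \<in> carrier H; y \<in> carrier H\<rbrakk> \<Longrightarrow> P (x \<oplus> y) = P x \<oplus> P y"
    and "\<And>c x. x \<in> carrier H \<Longrightarrow> P (c \<odot> x) = c \<odot> P x"
    and sa: "\<And>x y. \<lbrakk>x \<in> carrier H; y \<in> carrier H\<rbrakk> \<Longrightarrow> cinner H (P x) y = cinner H x (P y)"
    and PP: "\<And>x. x \<in> carrier H \<Longrightarrow> P (P x) = P x"
  shows "orth_proj H P"
  unfolding orth_proj_def
proof (intro conjI)
  show "P \<in> bounded_ops H"
  proof (rule bounded_opsI[where M = 1])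
    fix x assume x: "x \<in> carrier H"
    have "cinner H (P x) (P x) = cinner H x (P x)" using sa[OF x cl[OF x]] PP[OF x] by simp
    then show "hnorm H (P x) \<le> 1 * hnorm H x" using projection_norm_le[OF x cl[OF x]] by simp
  qed (fact assms)+
  show "compose (carrier H) P P = P"
    by (auto simp: compose_def fun_eq_iff PP ext)
qed (use sa in \<open>auto simp: self_adjoint_def\<close>)

text \<open>The range of \<open>P\<close> is closed because it is the set of fixed points of a continuous map.\<close>

lemma proj_space_chilbert:
  assumes P: "orth_proj H P"
  shows "chilbert_space (proj_space H P)"
proof -
  note P' = orth_projD[OF P]
  have range: "P ` carrier H = {x \<in> carrier H. P x = x}"
  proof (intro equalityI subsetI)
    show "x \<in> {x \<in> carrier H. P x = x}" if "x \<in> P ` carrier H" for x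
      using P'(4,5)[OF that] by simp
    show "x \<in> P ` carrier H" if "x \<in> {x \<in> carrier H. P x = x}" for x
      using that by (auto simp: image_iff intro!: bexI[of _ x])
  qed
  have [simp]: "hnorm (H\<lparr>carrier := C\<rparr>) x = hnorm H x" for x C by (simp add: hnorm_def)
  show ?thesis
    unfolding proj_space_def range
  proof (rule chilbert_spaceI; simp)
    fix u :: "nat \<Rightarrow> 'a" assume u: "\<And>n. u n \<in> carrier H \<and> P (u n) = u n"
      and cau: "\<And>e. 0 < e \<Longrightarrow> \<exists>N. \<forall>m\<ge>N. \<forall>n\<ge>N. hnorm H (u m \<oplus> (-1) \<odot> u n) < e"
    have "\<forall>e>0. \<exists>N. \<forall>m\<ge>N. \<forall>n\<ge>N. hnorm H (u m \<ominus> u n) < e"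
      using cau u by (simp add: diff_eq_smult)
    then obtain x where x: "x \<in> carrier H" "vlim u x"
      using complete[of u] u unfolding vlim_def by blast
    have "vlim u (P x)" using vlim_op[OF _ x P'(1)] u by simp
    then have "P x = x" using u x P'(1) by (intro vlim_unique[of u]) auto
    then show "\<exists>x. x \<in> carrier H \<and> P x = x \<and> (\<lambda>n. hnorm H (u n \<oplus> (-1) \<odot> x)) \<longlonglongrightarrow> 0"
      using x u by (intro exI[of _ x]) (simp add: vlim_def diff_eq_smult)
  next
    show "\<And>x. x \<in> carrier H \<and> P x = x \<Longrightarrow> x \<oplus> - 1 \<odot> x = \<zero>"
      using diff_self by (simp add: diff_eq_smult[symmetric])
  qed (use P'(1) in \<open>auto simp: op_linear smult_vector_add smult_scalar_add smult_smult
      M.a_assoc M.a_comm M.a_lcomm cinner_add_left cinner_smult_left cinner_nonneg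
      intro: cinner_commute cinner_definite\<close>)
qed

end

lemma hnorm_proj_space [simp]: "hnorm (proj_space K P) x = hnorm K x"
  by (simp add: hnorm_def proj_space_def)

lemma proj_space_simps [simp]:
  "carrier (proj_space K P) = P ` carrier K" "zero (proj_space K P) = zero K"
  "add (proj_space K P) = add K" "module.smult (proj_space K P) = module.smult K"
  "cinner (proj_space K P) = cinner K"
  by (simp_all add: proj_space_def)

context chilbert_space
begin

lemma proj_space_diff:
  assumes P: "orth_proj H P" and x: "x \<in> P ` carrier H" and y: "y \<in> P ` carrier H"
  shows "x \<ominus>\<^bsub>proj_space H P\<^esub> y = x \<ominus> y"
proof -
  interpret L: chilbert_space "proj_space H P" by (rule proj_space_chilbert[OF P])
  show ?thesis
    using x y orth_projD(4)[OF P] L.diff_eq_smult[of x y] by (simp add: diff_eq_smult)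
qed

lemma compression_bounded:
  assumes P: "orth_proj H P" and A: "A \<in> bounded_ops H" and sa: "self_adjoint H A"
  shows "compression H P A \<in> bounded_ops (proj_space H P)"
    and "self_adjoint (proj_space H P) (compression H P A)"
    and "x \<in> P ` carrier H \<Longrightarrow> cinner H (compression H P A x) x = cinner H (A x) x"
proof -
  note P' = orth_projD[OF P]
  interpret L: chilbert_space "proj_space H P" by (rule proj_space_chilbert[OF P])
  obtain M where M: "\<And>x. x \<in> carrier H \<Longrightarrow> hnorm H (A x) \<le> M * hnorm H x"
    using op_bound[OF A] by blast
  have cl: "A x \<in> carrier H" if "x \<in> carrier H" for x using A that by simp
  have PA: "cinner H (P (A x)) y = cinner H (A x) y" if "x \<in> P ` carrier H" "y \<in> P ` carrier H" for x y
    using P'(2) P'(5)[OF that(2)] P'(4)[OF that(1)] P'(4)[OF that(2)] cl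
    by (metis self_adjoint_def)
  show "compression H P A \<in> bounded_ops (proj_space H P)"
  proof (rule L.bounded_opsI[where M = M])
    fix x assume x: "x \<in> carrier (proj_space H P)"
    then have "x \<in> carrier H" using P'(4) by simp
    then show "hnorm (proj_space H P) (compression H P A x) \<le> M * hnorm (proj_space H P) x"
      using x M[of x] orth_proj_norm_le[OF P cl, of x] by (simp add: compression_def)
  next
    fix x y assume xy: "x \<in> carrier (proj_space H P)" "y \<in> carrier (proj_space H P)"
    then have "x \<oplus> y \<in> P ` carrier H" using L.M.a_closed by simp
    then show "compression H P A (x \<oplus>\<^bsub>proj_space H P\<^esub> y)
        = compression H P A x \<oplus>\<^bsub>proj_space H P\<^esub> compression H P A y"
      using xy P'(4) A P'(1) by (simp add: compression_def op_linear)
  next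
    fix c x assume x: "x \<in> carrier (proj_space H P)"
    then have "c \<odot> x \<in> P ` carrier H" using L.smult_cl by simp
    then show "compression H P A (c \<odot>\<^bsub>proj_space H P\<^esub> x)
        = c \<odot>\<^bsub>proj_space H P\<^esub> compression H P A x"
      using x P'(4) A P'(1) by (simp add: compression_def op_linear)
  qed (use cl P'(4) in \<open>auto simp: compression_def\<close>)
  show "self_adjoint (proj_space H P) (compression H P A)"
    unfolding self_adjoint_def
  proof (intro ballI)
    fix x y assume "x \<in> carrier (proj_space H P)" "y \<in> carrier (proj_space H P)"
    then have xy: "x \<in> P ` carrier H" "y \<in> P ` carrier H" by auto
    have c: "x \<in> carrier H" "y \<in> carrier H" using xy P'(4) by auto
    have "cinner H (P (A x)) y = cinner H x (A y)"
      using PA[OF xy] sa c by (simp add: self_adjoint_def)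
    also have "\<dots> = cnj (cinner H (P (A y)) x)"
      using PA[OF xy(2,1)] cinner_commute[OF c(1) cl[OF c(2)]] by simp
    also have "\<dots> = cinner H x (P (A y))"
      using cinner_commute[OF c(1), of "P (A y)"] cl[OF c(2)] P'(1) by simp
    finally show "cinner (proj_space H P) (compression H P A x) y
        = cinner (proj_space H P) x (compression H P A y)"
      using xy by (simp add: compression_def)
  qed
  show "x \<in> P ` carrier H \<Longrightarrow> cinner H (compression H P A x) x = cinner H (A x) x"
    using PA by (simp add: compression_def)
qed

lemma cfc_form_approx:
  assumes T: "T \<in> bounded_ops H" and sa: "self_adjoint H T"
    and form: "\<And>x. x \<in> carrier H \<Longrightarrow> m * (hnorm H x)\<^sup>2 \<le> Re (cinner H (T x) x)
      \<and> Re (cinner H (T x) x) \<le> M * (hnorm H x)\<^sup>2"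
    and g: "continuous_on {m..M} g"
    and q: "\<And>t. t \<in> {m..M} \<Longrightarrow> \<bar>poly q t - g t\<bar> \<le> e" "0 \<le> e"
    and x: "x \<in> carrier H" and y: "y \<in> carrier H"
  shows "cmod (cinner H (op_poly H q T x) y - cinner H (cfc H g T x) y) \<le> e * hnorm H x * hnorm H y"
proof -
  have S: "cfc H g T \<in> bounded_ops H" by (rule cfc_approx(1)[OF T sa form g])
  let ?z = "op_poly H q T x \<ominus> cfc H g T x"
  have z: "?z \<in> carrier H" using T S x by simp
  have "cmod (cinner H ?z y) \<le> hnorm H ?z * hnorm H y" by (rule Cauchy_Schwarz[OF z y])
  also have "\<dots> \<le> e * hnorm H x * hnorm H y"
    using cfc_approx(2)[OF T sa form g q x] y by (intro mult_right_mono) auto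
  finally show ?thesis using T S x y by (simp add: cinner_linear)
qed

end

text \<open>A linear map that intertwines two operators intertwines their polynomials; it need not be
  isometric, and the operators need not be self-adjoint.\<close>

lemma op_poly_intertwine:
  assumes H: "chilbert_space H" and L: "chilbert_space L"
    and S: "S \<in> bounded_ops H" and T: "T \<in> bounded_ops L"
    and cl: "\<And>x. x \<in> carrier H \<Longrightarrow> f x \<in> carrier L"
    and add: "\<And>x y. \<lbrakk>x \<in> carrier H; y \<in> carrier H\<rbrakk> \<Longrightarrow> f (x \<oplus>\<^bsub>H\<^esub> y) = f x \<oplus>\<^bsub>L\<^esub> f y"
    and smult: "\<And>c x. x \<in> carrier H \<Longrightarrow> f (c \<odot>\<^bsub>H\<^esub> x) = c \<odot>\<^bsub>L\<^esub> f x"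
    and comm: "\<And>x. x \<in> carrier H \<Longrightarrow> T (f x) = f (S x)"
    and x: "x \<in> carrier H"
  shows "op_poly L q T (f x) = f (op_poly H q S x)"
proof -
  interpret H: chilbert_space H by (rule H)
  interpret L: chilbert_space L by (rule L)
  have zero: "f \<zero>\<^bsub>H\<^esub> = \<zero>\<^bsub>L\<^esub>"
    using smult[of "\<zero>\<^bsub>H\<^esub>" 0] cl[of "\<zero>\<^bsub>H\<^esub>"] by simp
  show ?thesis
    by (induction q) (use S T x in \<open>simp_all add: cl zero add smult comm\<close>)
qed

section \<open>Strong operator convexity in terms of polynomials\<close>

lemma le_of_le_add_mult:
  fixes z w c :: real
  assumes "\<And>e. e > 0 \<Longrightarrow> z \<le> w + e * c" "0 \<le> c"
  shows "z \<le> w"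
proof (cases "c = 0")
  case True
  then show ?thesis using assms(1)[of 1] by simp
next
  case False
  then have c: "c > 0" using assms(2) by simp
  show ?thesis
  proof (rule field_le_epsilon)
    fix e :: real assume "e > 0"
    then show "z \<le> w + e" using assms(1)[of "e / c"] c by simp
  qed
qed

context chilbert_space
begin

text \<open>The defining inequality of strong operator convexity with \<open>g\<close> of the compression replaced by a
  polynomial. The interval for the compression is independent of that for \<open>D\<close>, because in the
  dilation below a part of the spectrum of \<open>D\<close> escapes to \<open>-\<infinity>\<close> as \<open>\<epsilon> \<rightarrow> 0\<close> while that of the compression stays in a
  fixed interval.\<close>

lemma soc_compression:
  assumes soc: "soc TYPE('a) {..<0} g"
    and D: "D \<in> bounded_ops H" and sa: "self_adjoint H D"
    and form: "\<And>x. x \<in> carrier H \<Longrightarrow> m * (hnorm H x)\<^sup>2 \<le> Re (cinner H (D x) x)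
      \<and> Re (cinner H (D x) x) \<le> M * (hnorm H x)\<^sup>2"
    and M: "M < 0" and P: "orth_proj H P"
    and form': "\<And>x. x \<in> P ` carrier H \<Longrightarrow> m' * (hnorm H x)\<^sup>2 \<le> Re (cinner H (D x) x)
      \<and> Re (cinner H (D x) x) \<le> M' * (hnorm H x)\<^sup>2"
    and M': "M' < 0"
    and q: "\<And>t. t \<in> {m'..M'} \<Longrightarrow> \<bar>poly q t - g t\<bar> \<le> e" "0 \<le> e"
    and f: "f \<in> carrier H"
  shows "Re (cinner H (op_poly (proj_space H P) q (compression H P D) (P f)) f)
    \<le> Re (cinner H (cfc H g D f) f) + e * (hnorm H f)\<^sup>2"
proof -
  let ?L = "proj_space H P" and ?C = "compression H P D"
  interpret L: chilbert_space ?L by (rule proj_space_chilbert[OF P])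
  note P' = orth_projD[OF P]
  note C = compression_bounded[OF P D sa]
  have cont: "continuous_on {..<0} g" using soc by (simp add: soc_def)
  have g: "continuous_on {m..M} g" "continuous_on {m'..M'} g"
    using M M' by (auto intro: continuous_on_subset[OF cont])
  have "op_spectrum H D \<subseteq> complex_of_real ` {m..M}"
    by (rule op_spectrum_subset[OF D sa form])
  also have "\<dots> \<subseteq> complex_of_real ` {..<0}" using M by auto
  finally have le: "op_le H (\<lambda>x\<in>carrier H. cfc ?L g ?C (P x)) (cfc H g D)"
    using soc chilbert_space_axioms D sa P unfolding soc_def by blast
  have Lform: "m' * (hnorm ?L x)\<^sup>2 \<le> Re (cinner ?L (?C x) x)
      \<and> Re (cinner ?L (?C x) x) \<le> M' * (hnorm ?L x)\<^sup>2" if "x \<in> carrier ?L" for x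
    using form'[of x] C(3)[of x] that by simp
  have S: "cfc ?L g ?C \<in> bounded_ops ?L" by (rule L.cfc_approx(1)[OF C(1,2) Lform g(2)])
  have Pf: "P f \<in> P ` carrier H" using f by simp
  let ?w = "op_poly ?L q ?C (P f)" and ?v = "cfc ?L g ?C (P f)" and ?u = "cfc H g D f"
  have w: "?w \<in> P ` carrier H" using L.op_closed[OF L.op_poly_bounded[OF C(1)]] Pf by simp
  have v: "?v \<in> P ` carrier H" using L.op_closed[OF S] Pf by simp
  have cl: "?w \<in> carrier H" "?v \<in> carrier H" using P'(4) w v by auto
  have u: "?u \<in> carrier H" using cfc_approx(1)[OF D sa form g(1)] f by simp
  have "cinner H (?u \<ominus> ?v) f \<in> \<real>\<^sub>\<ge>\<^sub>0"
    using le f by (simp add: op_le_def pos_op_def op_diff_def)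
  then have "Re (cinner H ?v f) \<le> Re (cinner H ?u f)"
    using u cl f by (simp add: cinner_linear complex_nonneg_Reals_iff)
  moreover have "Re (cinner H ?w f) - Re (cinner H ?v f) \<le> e * (hnorm H f)\<^sup>2"
  proof -
    have "hnorm ?L (?w \<ominus>\<^bsub>?L\<^esub> ?v) \<le> e * hnorm ?L (P f)"
      using Pf by (intro L.cfc_approx(2)[OF C(1,2) Lform g(2) q]) auto
    then have "hnorm H (?w \<ominus> ?v) \<le> e * hnorm H (P f)"
      using proj_space_diff[OF P w v] by simp
    also have "\<dots> \<le> e * hnorm H f"
      using orth_proj_norm_le[OF P f] q(2) by (rule mult_left_mono)
    finally have "hnorm H (?w \<ominus> ?v) * hnorm H f \<le> e * hnorm H f * hnorm H f"
      using f by (intro mult_right_mono) auto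
    moreover have "Re (cinner H (?w \<ominus> ?v) f) \<le> hnorm H (?w \<ominus> ?v) * hnorm H f"
      using Re_cinner_le[of "?w \<ominus> ?v" f] cl f by simp
    ultimately show ?thesis
      using cl f by (simp add: cinner_linear power2_eq_square mult.assoc)
  qed
  ultimately show ?thesis by simp
qed

end

section \<open>The Hilbert space of pairs\<close>

definition pair :: "'a chilbert \<Rightarrow> 'a \<Rightarrow> 'a \<Rightarrow> nat \<Rightarrow> 'a" where
  "pair H x y = (\<lambda>n. if n = 0 then x else if n = 1 then y else \<zero>\<^bsub>H\<^esub>)"

text \<open>The direct sum of \<open>H\<close> and of \<open>H\<close> with the inner product \<open>\<langle>E x, y\<rangle>\<close>. Pairs are sequences that vanish
  from index 2 on, which puts the space into the universe type \<open>nat \<Rightarrow> 'a\<close>.\<close>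

definition pair_space :: "'a chilbert \<Rightarrow> ('a \<Rightarrow> 'a) \<Rightarrow> (nat \<Rightarrow> 'a) chilbert" where
  "pair_space H E = \<lparr>carrier = {pair H x y | x y. x \<in> carrier H \<and> y \<in> carrier H},
     monoid.mult = (\<lambda>f h. f), one = pair H \<zero>\<^bsub>H\<^esub> \<zero>\<^bsub>H\<^esub>, zero = pair H \<zero>\<^bsub>H\<^esub> \<zero>\<^bsub>H\<^esub>,
     add = (\<lambda>f h n. f n \<oplus>\<^bsub>H\<^esub> h n), module.smult = (\<lambda>c f n. c \<odot>\<^bsub>H\<^esub> f n),
     cinner = (\<lambda>f h. cinner H (f 0) (h 0) + cinner H (E (f 1)) (h 1))\<rparr>"

definition pair_diag :: "'a chilbert \<Rightarrow> ('a \<Rightarrow> 'a) \<Rightarrow> ('a \<Rightarrow> 'a) \<Rightarrow> real \<Rightarrow> (nat \<Rightarrow> 'a) \<Rightarrow> nat \<Rightarrow> 'a" where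
  "pair_diag H E b s = (\<lambda>f\<in>carrier (pair_space H E). pair H (b (f 0)) (of_real s \<odot>\<^bsub>H\<^esub> f 1))"

lemma pair_simps [simp]: "pair H x y 0 = x" "pair H x y (Suc 0) = y"
  by (auto simp: pair_def)

lemma pair_in_carrier [simp]:
  "\<lbrakk>x \<in> carrier H; y \<in> carrier H\<rbrakk> \<Longrightarrow> pair H x y \<in> carrier (pair_space H E)"
  by (auto simp: pair_space_def)

lemma pair_space_cases:
  assumes "f \<in> carrier (pair_space H E)"
  obtains x y where "f = pair H x y" "x \<in> carrier H" "y \<in> carrier H"
  using assms by (auto simp: pair_space_def)

lemma pair_zero [simp]: "\<zero>\<^bsub>pair_space H E\<^esub> = pair H \<zero>\<^bsub>H\<^esub> \<zero>\<^bsub>H\<^esub>"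
  by (simp add: pair_space_def)

lemma pair_cinner [simp]:
  "cinner (pair_space H E) (pair H x y) (pair H x' y') = cinner H x x' + cinner H (E y) y'"
  by (simp add: pair_space_def)

lemma pair_hnorm:
  "hnorm (pair_space H E) (pair H x y) = sqrt (Re (cinner H x x) + Re (cinner H (E y) y))"
  by (simp add: hnorm_def)

context chilbert_space
begin

lemma pair_add [simp]:
  "pair H x y \<oplus>\<^bsub>pair_space H E\<^esub> pair H x' y' = pair H (x \<oplus> x') (y \<oplus> y')"
  by (auto simp: pair_space_def pair_def)

lemma pair_smult [simp]: "c \<odot>\<^bsub>pair_space H E\<^esub> pair H x y = pair H (c \<odot> x) (c \<odot> y)"
  by (auto simp: pair_space_def pair_def)

lemma pair_diag_pair [simp]:
  "\<lbrakk>x \<in> carrier H; y \<in> carrier H\<rbrakk> \<Longrightarrow> pair_diag H E b s (pair H x y) = pair H (b x) (of_real s \<odot> y)"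
  by (simp add: pair_diag_def)

end

text \<open>The weights \<open>E\<close> for which \<open>\<langle>E x, y\<rangle>\<close> is an inner product with a norm equivalent to that of \<open>H\<close>.\<close>

locale coercive_op = chilbert_space +
  fixes E :: "'a \<Rightarrow> 'a" and d :: real
  assumes E: "E \<in> bounded_ops H" and E_sa: "self_adjoint H E" and d: "d > 0"
    and E_coercive: "\<And>x. x \<in> carrier H \<Longrightarrow> d * (hnorm H x)\<^sup>2 \<le> Re (cinner H (E x) x)"
begin

lemma E_form_nonneg: "x \<in> carrier H \<Longrightarrow> 0 \<le> Re (cinner H (E x) x)"
  using E_coercive[of x] d by (meson order_trans mult_nonneg_nonneg less_imp_le zero_le_power2)

lemma E_Im: "x \<in> carrier H \<Longrightarrow> Im (cinner H (E x) x) = 0"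
  by (rule self_adjoint_Im[OF E E_sa])

lemma pair_hnorm_square:
  "\<lbrakk>x \<in> carrier H; y \<in> carrier H\<rbrakk>
    \<Longrightarrow> (hnorm (pair_space H E) (pair H x y))\<^sup>2 = (hnorm H x)\<^sup>2 + Re (cinner H (E y) y)"
  using E_form_nonneg[of y] by (simp add: pair_hnorm cinner_self)

text \<open>Coercivity of \<open>E\<close> makes the second summand an equivalent norm, so both components of a
  Cauchy sequence are Cauchy.\<close>

lemma pair_space_complete:
  fixes u :: "nat \<Rightarrow> nat \<Rightarrow> 'a"
  assumes u: "\<And>n. u n \<in> carrier (pair_space H E)"
    and cau: "\<And>e. e > 0 \<Longrightarrow> \<exists>N. \<forall>m\<ge>N. \<forall>n\<ge>N. hnorm (pair_space H E)
        (u m \<oplus>\<^bsub>pair_space H E\<^esub> (-1) \<odot>\<^bsub>pair_space H E\<^esub> u n) < e"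
  shows "\<exists>f\<in>carrier (pair_space H E). (\<lambda>n. hnorm (pair_space H E)
        (u n \<oplus>\<^bsub>pair_space H E\<^esub> (-1) \<odot>\<^bsub>pair_space H E\<^esub> f)) \<longlonglongrightarrow> 0"
proof -
  let ?K = "pair_space H E"
  define a where "a n = u n 0" for n
  define b where "b n = u n 1" for n
  have ab: "u n = pair H (a n) (b n)" "a n \<in> carrier H" "b n \<in> carrier H" for n
    using u[of n] by (auto simp: a_def b_def elim!: pair_space_cases)
  have diff: "pair H x y \<oplus>\<^bsub>?K\<^esub> (-1) \<odot>\<^bsub>?K\<^esub> pair H x' y' = pair H (x \<ominus> x') (y \<ominus> y')"
    if "x \<in> carrier H" "y \<in> carrier H" "x' \<in> carrier H" "y' \<in> carrier H" for x y x' y'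
    using that by (simp add: diff_eq_smult)
  have first: "hnorm H x \<le> hnorm ?K (pair H x y)"
    and second: "sqrt d * hnorm H y \<le> hnorm ?K (pair H x y)"
    if xy: "x \<in> carrier H" "y \<in> carrier H" for x y
  proof -
    have K: "hnorm ?K (pair H x y) = sqrt ((hnorm H x)\<^sup>2 + Re (cinner H (E y) y))"
      using xy by (simp add: pair_hnorm hnorm_square)
    show "hnorm H x \<le> hnorm ?K (pair H x y)"
      unfolding K using E_form_nonneg xy by (intro real_le_rsqrt) simp
    show "sqrt d * hnorm H y \<le> hnorm ?K (pair H x y)"
      unfolding K using E_coercive[of y] xy d
      by (intro real_le_rsqrt) (simp add: power_mult_distrib add_increasing)
  qed
  have "\<forall>e>0. \<exists>N. \<forall>m\<ge>N. \<forall>n\<ge>N. hnorm H (a m \<ominus> a n) < e"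
  proof (intro allI impI)
    fix e :: real assume "e > 0"
    then obtain N where "\<forall>m\<ge>N. \<forall>n\<ge>N. hnorm ?K (pair H (a m \<ominus> a n) (b m \<ominus> b n)) < e"
      using cau[of e] unfolding ab(1) diff[OF ab(2,3) ab(2,3)] by auto
    then show "\<exists>N. \<forall>m\<ge>N. \<forall>n\<ge>N. hnorm H (a m \<ominus> a n) < e"
      using first ab(2,3) by (meson M.minus_closed le_less_trans)
  qed
  then obtain x where x: "x \<in> carrier H" "(\<lambda>n. hnorm H (a n \<ominus> x)) \<longlonglongrightarrow> 0"
    using complete[of a] ab(2) by blast
  have "\<forall>e>0. \<exists>N. \<forall>m\<ge>N. \<forall>n\<ge>N. hnorm H (b m \<ominus> b n) < e"
  proof (intro allI impI)
    fix e :: real assume "e > 0"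
    then have "sqrt d * e > 0" using d by simp
    then obtain N where N: "\<forall>m\<ge>N. \<forall>n\<ge>N. hnorm ?K (pair H (a m \<ominus> a n) (b m \<ominus> b n)) < sqrt d * e"
      using cau[of "sqrt d * e"] unfolding ab(1) diff[OF ab(2,3) ab(2,3)] by auto
    have "hnorm H (b m \<ominus> b n) < e" if "m \<ge> N" "n \<ge> N" for m n
    proof -
      have "sqrt d * hnorm H (b m \<ominus> b n) < sqrt d * e"
        using second[of "a m \<ominus> a n" "b m \<ominus> b n"] N that ab(2,3)
        by (meson M.minus_closed le_less_trans)
      then show ?thesis using d by simp
    qed
    then show "\<exists>N. \<forall>m\<ge>N. \<forall>n\<ge>N. hnorm H (b m \<ominus> b n) < e" by blast
  qed
  then obtain y where y: "y \<in> carrier H" "(\<lambda>n. hnorm H (b n \<ominus> y)) \<longlonglongrightarrow> 0"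
    using complete[of b] ab(3) by blast
  obtain N where N: "\<And>x. x \<in> carrier H \<Longrightarrow> Re (cinner H (E x) x) \<le> N * (hnorm H x)\<^sup>2"
    using op_form_bound[OF E] by blast
  have bound: "hnorm ?K (pair H (a n \<ominus> x) (b n \<ominus> y))
      \<le> sqrt ((hnorm H (a n \<ominus> x))\<^sup>2 + N * (hnorm H (b n \<ominus> y))\<^sup>2)" for n
    using N[of "b n \<ominus> y"] x y ab by (simp add: pair_hnorm hnorm_square)
  have nonneg: "0 \<le> hnorm ?K (pair H (a n \<ominus> x) (b n \<ominus> y))" for n
    using first[of "a n \<ominus> x" "b n \<ominus> y"] x y ab hnorm_ge0[of "a n \<ominus> x"]
    by (meson M.minus_closed order_trans)
  have "(\<lambda>n. sqrt ((hnorm H (a n \<ominus> x))\<^sup>2 + N * (hnorm H (b n \<ominus> y))\<^sup>2)) \<longlonglongrightarrow> sqrt (0\<^sup>2 + N * 0\<^sup>2)"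
    using x y by (intro tendsto_intros)
  then have "(\<lambda>n. sqrt ((hnorm H (a n \<ominus> x))\<^sup>2 + N * (hnorm H (b n \<ominus> y))\<^sup>2)) \<longlonglongrightarrow> 0"
    by simp
  then have "(\<lambda>n. hnorm ?K (pair H (a n \<ominus> x) (b n \<ominus> y))) \<longlonglongrightarrow> 0"
    by (rule tendsto_sandwich[OF always_eventually[OF allI[OF nonneg]]
          always_eventually[OF allI[OF bound]] tendsto_const])
  then have "(\<lambda>n. hnorm ?K (u n \<oplus>\<^bsub>?K\<^esub> (-1) \<odot>\<^bsub>?K\<^esub> pair H x y)) \<longlonglongrightarrow> 0"
    unfolding ab(1) diff[OF ab(2,3) x(1) y(1)] .
  then show ?thesis using x y by (intro bexI[of _ "pair H x y"]) auto
qed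

lemma pair_space_chilbert: "chilbert_space (pair_space H E)"
proof (rule chilbert_spaceI)
  let ?K = "pair_space H E"
  have E_cl: "E x \<in> carrier H" if "x \<in> carrier H" for x using E that by simp
  fix f assume f: "f \<in> carrier ?K"
  then obtain x y where xy: "f = pair H x y" "x \<in> carrier H" "y \<in> carrier H"
    by (rule pair_space_cases)
  show "f \<oplus>\<^bsub>?K\<^esub> (-1) \<odot>\<^bsub>?K\<^esub> f = \<zero>\<^bsub>?K\<^esub>"
    using xy diff_self by (simp add: diff_eq_smult[symmetric])
  show "cinner ?K f f \<in> \<real>\<^sub>\<ge>\<^sub>0"
    using xy cinner_nonneg[of x] E_form_nonneg[of y] E_Im[of y]
    by (simp add: complex_nonneg_Reals_iff)
  show "f = \<zero>\<^bsub>?K\<^esub>" if "cinner ?K f f = 0"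
  proof -
    have "(hnorm H x)\<^sup>2 + Re (cinner H (E y) y) = 0"
      using that xy by (simp add: complex_eq_iff hnorm_square)
    moreover have "d * (hnorm H y)\<^sup>2 \<le> Re (cinner H (E y) y)" "0 \<le> d * (hnorm H y)\<^sup>2"
      using E_coercive xy d by auto
    ultimately have "(hnorm H x)\<^sup>2 = 0" "d * (hnorm H y)\<^sup>2 = 0"
      using zero_le_power2[of "hnorm H x"] by linarith+
    then show ?thesis using xy d by simp
  qed
  fix h assume "h \<in> carrier ?K"
  then obtain x' y' where xy': "h = pair H x' y'" "x' \<in> carrier H" "y' \<in> carrier H"
    by (rule pair_space_cases)
  have "cinner H (E y) y' = cnj (cinner H (E y') y)"
    using E_sa xy xy' E_cl cinner_commute[of y "E y'"] by (simp add: self_adjoint_def)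
  then show "cinner ?K f h = cnj (cinner ?K h f)"
    using xy xy' cinner_commute[of x x'] by simp
next
  show "\<And>u. \<lbrakk>\<And>n. u n \<in> carrier (pair_space H E);
        \<And>e. e > 0 \<Longrightarrow> \<exists>N::nat. \<forall>m\<ge>N. \<forall>n\<ge>N. hnorm (pair_space H E)
          (u m \<oplus>\<^bsub>pair_space H E\<^esub> (-1) \<odot>\<^bsub>pair_space H E\<^esub> u n) < e\<rbrakk>
        \<Longrightarrow> \<exists>x\<in>carrier (pair_space H E). (\<lambda>n. hnorm (pair_space H E)
          (u n \<oplus>\<^bsub>pair_space H E\<^esub> (-1) \<odot>\<^bsub>pair_space H E\<^esub> x)) \<longlonglongrightarrow> 0"
    by (rule pair_space_complete)
qed (use E in \<open>auto elim!: pair_space_cases simp: M.a_assoc M.a_comm M.a_lcomm smult_scalar_add smult_vector_add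
    smult_smult cinner_linear op_linear algebra_simps\<close>)

context
  fixes b and mb Mb s :: real and g :: "real \<Rightarrow> real"
  assumes b: "b \<in> bounded_ops H" and b_sa: "self_adjoint H b"
    and b_form: "\<And>x. x \<in> carrier H \<Longrightarrow> mb * (hnorm H x)\<^sup>2 \<le> Re (cinner H (b x) x)
      \<and> Re (cinner H (b x) x) \<le> Mb * (hnorm H x)\<^sup>2"
    and Mb: "Mb < 0" and s: "s < 0"
begin

lemma pair_diag_bounded: "pair_diag H E b s \<in> bounded_ops (pair_space H E)"
proof -
  interpret K: chilbert_space "pair_space H E" by (rule pair_space_chilbert)
  obtain N where N: "N > 0" "\<And>x. x \<in> carrier H \<Longrightarrow> hnorm H (b x) \<le> N * hnorm H x"
    using op_bound[OF b] by blast
  show ?thesis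
  proof (rule K.bounded_opsI[where M = "N + \<bar>s\<bar>"])
    fix f assume "f \<in> carrier (pair_space H E)"
    then obtain x y where f: "f = pair H x y" "x \<in> carrier H" "y \<in> carrier H"
      by (rule pair_space_cases)
    let ?D = "pair_diag H E b s"
    have "Re (cinner H (E (of_real s \<odot> y)) (of_real s \<odot> y)) = s\<^sup>2 * Re (cinner H (E y) y)"
      using f E by (simp add: op_linear cinner_linear power2_eq_square)
    then have "(hnorm (pair_space H E) (?D f))\<^sup>2 = (hnorm H (b x))\<^sup>2 + s\<^sup>2 * Re (cinner H (E y) y)"
      using f b by (simp add: pair_hnorm_square)
    also have "\<dots> \<le> (N * hnorm H x)\<^sup>2 + s\<^sup>2 * Re (cinner H (E y) y)"
      using N(2)[of x] f b by (intro add_right_mono power_mono) auto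
    also have "\<dots> \<le> (N + \<bar>s\<bar>)\<^sup>2 * (hnorm H x)\<^sup>2 + (N + \<bar>s\<bar>)\<^sup>2 * Re (cinner H (E y) y)"
      unfolding power_mult_distrib using N(1) E_form_nonneg[of y] f
      by (intro add_mono mult_right_mono) (auto simp: power2_sum intro!: add_nonneg_nonneg)
    also have "\<dots> = ((N + \<bar>s\<bar>) * hnorm (pair_space H E) f)\<^sup>2"
      using f by (simp add: power_mult_distrib pair_hnorm_square distrib_left)
    finally show "hnorm (pair_space H E) (?D f) \<le> (N + \<bar>s\<bar>) * hnorm (pair_space H E) f"
      using N(1) K.hnorm_ge0[of f] f by (intro power2_le_imp_le[OF _ mult_nonneg_nonneg]) auto
  qed (use b in \<open>auto elim!: pair_space_cases simp: op_linear smult_vector_add smult_smult mult.commute pair_diag_def\<close>)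
qed

lemma pair_diag_self_adjoint: "self_adjoint (pair_space H E) (pair_diag H E b s)"
  using b_sa b E by (auto elim!: pair_space_cases simp: self_adjoint_def cinner_linear op_linear)

lemma pair_diag_form:
  assumes "f \<in> carrier (pair_space H E)"
  shows "min mb s * (hnorm (pair_space H E) f)\<^sup>2 \<le> Re (cinner (pair_space H E) (pair_diag H E b s f) f)
    \<and> Re (cinner (pair_space H E) (pair_diag H E b s f) f) \<le> max Mb s * (hnorm (pair_space H E) f)\<^sup>2"
proof -
  obtain x y where f: "f = pair H x y" "x \<in> carrier H" "y \<in> carrier H"
    using assms by (rule pair_space_cases)
  have eq: "Re (cinner (pair_space H E) (pair_diag H E b s f) f)
      = Re (cinner H (b x) x) + s * Re (cinner H (E y) y)"
    using f E by (simp add: op_linear cinner_linear)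
  have "min mb s * (hnorm H x)\<^sup>2 \<le> mb * (hnorm H x)\<^sup>2" "Mb * (hnorm H x)\<^sup>2 \<le> max Mb s * (hnorm H x)\<^sup>2"
    by (auto intro!: mult_right_mono)
  then have "min mb s * (hnorm H x)\<^sup>2 \<le> Re (cinner H (b x) x)"
    "Re (cinner H (b x) x) \<le> max Mb s * (hnorm H x)\<^sup>2"
    using b_form[OF f(2)] order_trans by blast+
  moreover have "min mb s * Re (cinner H (E y) y) \<le> s * Re (cinner H (E y) y)"
    "s * Re (cinner H (E y) y) \<le> max Mb s * Re (cinner H (E y) y)"
    using E_form_nonneg[OF f(3)] by (auto intro!: mult_right_mono)
  ultimately show ?thesis
    unfolding eq unfolding f(1) pair_hnorm_square[OF f(2,3)] distrib_left
    by (intro conjI add_mono)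
qed

text \<open>The map \<open>x \<mapsto> (x, 0)\<close> intertwines \<open>b\<close> with the diagonal operator, hence also their polynomials. The
  identity is exact, so it does not depend on how far \<open>s\<close> lies from the spectrum of \<open>b\<close>.\<close>

lemma cfc_pair_diag:
  assumes g: "continuous_on {..<0} g" and k: "k \<in> carrier H"
  shows "cinner (pair_space H E) (cfc (pair_space H E) g (pair_diag H E b s) (pair H k \<zero>)) (pair H k \<zero>)
    = cinner H (cfc H g b k) k"
proof -
  let ?K = "pair_space H E" and ?D = "pair_diag H E b s" and ?f = "pair H k \<zero>"
  interpret K: chilbert_space ?K by (rule pair_space_chilbert)
  let ?z = "cinner ?K (cfc ?K g ?D ?f) ?f - cinner H (cfc H g b k) k"
  let ?m = "min mb s" and ?M = "max Mb s"
  have f: "?f \<in> carrier ?K" using k by simp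
  have nf: "hnorm ?K ?f = hnorm H k"
    using k E by (simp add: pair_hnorm hnorm_def)
  have g1: "continuous_on {?m..?M} g" and g2: "continuous_on {mb..Mb} g"
    by (intro continuous_on_subset[OF g]; use Mb s in \<open>auto simp: le_max_iff_disj\<close>)+
  have "cmod ?z \<le> 0"
  proof (rule le_of_le_add_mult)
    fix e :: real assume e: "e > 0"
    obtain q where q: "\<And>t. t \<in> {?m..?M} \<Longrightarrow> \<bar>poly q t - g t\<bar> < e"
      using Weierstrass_real_poly[OF g1 e] by blast
    have "op_poly ?K q ?D ?f = pair H (op_poly H q b k) \<zero>"
      using b E k
      by (intro op_poly_intertwine[where f = "\<lambda>x. pair H x \<zero>", OF chilbert_space_axioms pair_space_chilbert b
            pair_diag_bounded]) auto
    then have eq: "cinner ?K (op_poly ?K q ?D ?f) ?f = cinner H (op_poly H q b k) k"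
      using E k by simp
    have "cmod (cinner ?K (op_poly ?K q ?D ?f) ?f - cinner ?K (cfc ?K g ?D ?f) ?f)
        \<le> e * hnorm ?K ?f * hnorm ?K ?f"
      using q e by (intro K.cfc_form_approx[OF pair_diag_bounded pair_diag_self_adjoint pair_diag_form g1 _ _ f f])
        (auto intro!: less_imp_le)
    moreover have "cmod (cinner H (op_poly H q b k) k - cinner H (cfc H g b k) k)
        \<le> e * hnorm H k * hnorm H k"
      using q e by (intro cfc_form_approx[OF b b_sa b_form g2 _ _ k k])
        (auto intro!: less_imp_le simp: min_le_iff_disj le_max_iff_disj)
    ultimately show "cmod ?z \<le> 0 + e * (2 * (hnorm H k)\<^sup>2)"
      using norm_triangle_ineq4[of "cinner H (op_poly H q b k) k - cinner H (cfc H g b k) k"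
          "cinner H (op_poly H q b k) k - cinner ?K (cfc ?K g ?D ?f) ?f"]
      unfolding eq nf by (simp add: power2_eq_square algebra_simps)
  qed simp
  then show ?thesis by simp
qed

text \<open>Strong operator convexity for the zero projection: the compression acts on the zero space, so the
  left-hand side vanishes.\<close>

lemma soc_cfc_nonneg:
  assumes soc: "soc TYPE(nat \<Rightarrow> 'a) {..<0} g" and k: "k \<in> carrier H"
  shows "0 \<le> Re (cinner H (cfc H g b k) k)"
proof (rule le_of_le_add_mult)
  let ?K = "pair_space H E" and ?D = "pair_diag H E b s" and ?f = "pair H k \<zero>"
  let ?m = "min mb s" and ?M = "max Mb s"
  interpret K: chilbert_space ?K by (rule pair_space_chilbert)
  have f: "?f \<in> carrier ?K" using k by simp
  have nf: "hnorm ?K ?f = hnorm H k"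
    using k E by (simp add: pair_hnorm hnorm_def)
  have cont: "continuous_on {..<0} g" using soc by (simp add: soc_def)
  have g1: "continuous_on {?m..?M} g"
    by (intro continuous_on_subset[OF cont]) (use Mb s in \<open>auto simp: le_max_iff_disj\<close>)
  let ?P = "op_scalar ?K 0"
  have P0: "?P h = \<zero>\<^bsub>?K\<^esub>" if "h \<in> carrier ?K" for h
    using that K.smult_0 by (simp add: op_scalar_def del: pair_zero)
  have P: "orth_proj ?K ?P"
    unfolding orth_proj_def
  proof (intro conjI)
    show "self_adjoint ?K ?P" using P0 by (simp add: self_adjoint_def del: pair_zero)
    show "compose (carrier ?K) ?P ?P = ?P"
      using P0 by (auto simp: compose_def op_scalar_def simp del: pair_zero)
  qed simp
  fix e :: real assume e: "e > 0"
  obtain q where q: "\<And>t. t \<in> {?m..?M} \<Longrightarrow> \<bar>poly q t - g t\<bar> < e"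
    using Weierstrass_real_poly[OF g1 e] by blast
  have "Re (cinner ?K (op_poly (proj_space ?K ?P) q (compression ?K ?P ?D) (?P ?f)) ?f)
      \<le> Re (cinner ?K (cfc ?K g ?D ?f) ?f) + e * (hnorm ?K ?f)\<^sup>2"
    using q e Mb s f pair_diag_form K.orth_projD(4)[OF P]
    by (intro K.soc_compression[OF soc pair_diag_bounded pair_diag_self_adjoint pair_diag_form _ P, where m' = ?m and M' = ?M])
      (auto intro: less_imp_le simp del: pair_zero)
  moreover have "op_poly (proj_space ?K ?P) q (compression ?K ?P ?D) (?P ?f) = \<zero>\<^bsub>?K\<^esub>"
  proof -
    interpret L: chilbert_space "proj_space ?K ?P" by (rule K.proj_space_chilbert[OF P])
    have "op_poly (proj_space ?K ?P) q (compression ?K ?P ?D) \<in> bounded_ops (proj_space ?K ?P)"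
      using K.compression_bounded[OF P pair_diag_bounded pair_diag_self_adjoint] by simp
    from L.op_vector_zero[OF this] show ?thesis using P0[OF f] by simp
  qed
  ultimately show "0 \<le> Re (cinner H (cfc H g b k) k) + e * (hnorm H k)\<^sup>2"
    using f cfc_pair_diag[OF cont k] nf K.cinner_zero_left[OF f] by (simp del: pair_zero pair_cinner)
qed simp

end

end

section \<open>Operator monotonicity\<close>

context coercive_op
begin

text \<open>\<open>R\<close> is \<open>(1 + E)\<^sup>-\<^sup>1\<close>. The projection onto the diagonal is \<open>(x, y) \<mapsto> (z, z)\<close> with
  \<open>z = R (x + E y)\<close>, and \<open>x \<mapsto> (x, x)\<close> intertwines \<open>R T\<close> with the compression of
  \<open>(x, y) \<mapsto> (b x, s y)\<close>. This map is not isometric and \<open>R T\<close> need not be self-adjoint on \<open>H\<close>, which is why the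
  conclusion speaks of a polynomial of \<open>R T\<close>. The vector \<open>(k, 0)\<close> is projected to \<open>(R k, R k)\<close>.\<close>

lemma soc_dilation:
  assumes soc: "soc TYPE(nat \<Rightarrow> 'a) {..<0} g"
    and b: "b \<in> bounded_ops H" "self_adjoint H b"
      "\<And>x. x \<in> carrier H \<Longrightarrow> mb * (hnorm H x)\<^sup>2 \<le> Re (cinner H (b x) x)
        \<and> Re (cinner H (b x) x) \<le> Mb * (hnorm H x)\<^sup>2"
    and Mb: "Mb < 0" and s: "s < 0"
    and R: "R \<in> bounded_ops H" and R_right: "\<And>x. x \<in> carrier H \<Longrightarrow> R x \<oplus> E (R x) = x"
    and R_left: "\<And>x. x \<in> carrier H \<Longrightarrow> R (x \<oplus> E x) = x"
    and T: "T \<in> bounded_ops H" "\<And>x. x \<in> carrier H \<Longrightarrow> T x = b x \<oplus> complex_of_real s \<odot> E x"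
    and form': "\<And>x. x \<in> carrier H \<Longrightarrow>
        m' * ((hnorm H x)\<^sup>2 + Re (cinner H (E x) x)) \<le> Re (cinner H (T x) x)
        \<and> Re (cinner H (T x) x) \<le> M' * ((hnorm H x)\<^sup>2 + Re (cinner H (E x) x))"
    and M': "M' < 0"
    and q: "\<And>t. t \<in> {m'..M'} \<Longrightarrow> \<bar>poly q t - g t\<bar> \<le> e" "0 \<le> e"
    and k: "k \<in> carrier H"
  shows "Re (cinner H (op_poly H q (compose (carrier H) R T) (R k)) k)
    \<le> Re (cinner H (cfc H g b k) k) + e * (hnorm H k)\<^sup>2"
proof -
  have cont: "continuous_on {..<0} g" using soc by (simp add: soc_def)
  let ?K = "pair_space H E" and ?D = "pair_diag H E b s" and ?f = "pair H k \<zero>"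
  interpret K: chilbert_space ?K by (rule pair_space_chilbert)
  have cl [simp]: "E x \<in> carrier H" "R x \<in> carrier H" "b x \<in> carrier H" if "x \<in> carrier H" for x
    using that E R b by auto
  define r where "r f = R (f 0 \<oplus> E (f 1))" for f :: "nat \<Rightarrow> 'a"
  define P where "P = (\<lambda>f\<in>carrier ?K. pair H (r f) (r f))"
  have r [simp]: "r (pair H x y) = R (x \<oplus> E y)" for x y by (simp add: r_def)
  have P_pair [simp]: "P (pair H x y) = pair H (R (x \<oplus> E y)) (R (x \<oplus> E y))"
    if "x \<in> carrier H" "y \<in> carrier H" for x y
    using that by (simp add: P_def)
  have form: "cinner ?K (P (pair H x y)) (pair H x' y')
      = cinner H (R (x \<oplus> E y)) (R (x' \<oplus> E y')) + cinner H (E (R (x \<oplus> E y))) (R (x' \<oplus> E y'))"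
    if xy: "x \<in> carrier H" "y \<in> carrier H" "x' \<in> carrier H" "y' \<in> carrier H" for x y x' y'
  proof -
    let ?r = "R (x \<oplus> E y)" and ?r' = "R (x' \<oplus> E y')"
    have Er: "cinner H (E u) v = cinner H u (E v)" if "u \<in> carrier H" "v \<in> carrier H" for u v
      using E_sa that by (simp add: self_adjoint_def)
    have "cinner ?K (P (pair H x y)) (pair H x' y') = cinner H ?r (x' \<oplus> E y')"
      using xy by (simp add: Er cinner_linear)
    also have "\<dots> = cinner H ?r (?r' \<oplus> E ?r')"
      using xy by (simp add: R_right)
    finally show ?thesis using xy by (simp add: Er cinner_linear)
  qed
  have P: "orth_proj ?K P"
  proof (rule K.orth_projI)
    fix f assume "f \<in> carrier ?K"
    then obtain x y where f: "f = pair H x y" "x \<in> carrier H" "y \<in> carrier H"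
      by (rule pair_space_cases)
    show "P f \<in> carrier ?K" "P (P f) = P f" using f by (simp_all add: R_left)
    show "P (c \<odot>\<^bsub>?K\<^esub> f) = c \<odot>\<^bsub>?K\<^esub> P f" for c
    proof -
      have "c \<odot> x \<oplus> E (c \<odot> y) = c \<odot> (x \<oplus> E y)" using f E by (simp add: op_linear smult_vector_add)
      then show ?thesis using f R by (simp add: op_vector_smult)
    qed
    fix h assume "h \<in> carrier ?K"
    then obtain x' y' where h: "h = pair H x' y'" "x' \<in> carrier H" "y' \<in> carrier H"
      by (rule pair_space_cases)
    have "(x \<oplus> x') \<oplus> E (y \<oplus> y') = (x \<oplus> E y) \<oplus> (x' \<oplus> E y')"
      using f h E by (simp add: op_linear M.add.m_ac)
    then show "P (f \<oplus>\<^bsub>?K\<^esub> h) = P f \<oplus>\<^bsub>?K\<^esub> P h"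
      using f h R by (simp add: op_vector_add)
    let ?r = "R (x \<oplus> E y)" and ?r' = "R (x' \<oplus> E y')"
    have rr: "?r \<in> carrier H" "?r' \<in> carrier H" using f h by auto
    have "cinner ?K f (P h) = cnj (cinner ?K (P h) f)"
      using f h by (intro K.cinner_commute) auto
    also have "\<dots> = cinner H ?r ?r' + cinner H ?r (E ?r')"
      unfolding f(1) h(1) using f h rr cinner_commute[of ?r ?r'] cinner_commute[of ?r "E ?r'"]
      by (simp only: form complex_cnj_add cl)
    also have "\<dots> = cinner ?K (P f) h"
      unfolding f(1) h(1) using f h rr E_sa by (simp only: form) (simp add: self_adjoint_def)
    finally show "cinner ?K (P f) h = cinner ?K f (P h)" by simp
  qed (simp add: P_def)
  have diagonal: "\<exists>x\<in>carrier H. f = pair H x x" if "f \<in> P ` carrier ?K" for f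
    using that by (auto elim!: pair_space_cases)
  have diag_mem: "pair H x x \<in> P ` carrier ?K" if x: "x \<in> carrier H" for x
    using x by (intro image_eqI[of _ _ "pair H x x"]) (simp_all add: R_left)
  have sE: "b x \<oplus> E (of_real s \<odot> x) = T x" if "x \<in> carrier H" for x
    using that T(2) E by (simp add: op_linear)
  note D = pair_diag_bounded[OF b Mb s] pair_diag_self_adjoint[OF b Mb s]
  note D_form = pair_diag_form[OF b Mb s]
  let ?L = "proj_space ?K P" and ?C = "compression ?K P ?D" and ?a = "compose (carrier H) R T"
  have Pf: "P ?f = pair H (R k) (R k)" using k E by simp
  have a: "?a \<in> bounded_ops H" using R T by simp
  have "op_poly ?L q ?C (pair H (R k) (R k)) = pair H (op_poly H q ?a (R k)) (op_poly H q ?a (R k))"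
  proof (rule op_poly_intertwine[where f = "\<lambda>x. pair H x x", OF chilbert_space_axioms
        K.proj_space_chilbert[OF P] a K.compression_bounded(1)[OF P D]])
    fix x assume x: "x \<in> carrier H"
    then show "?C (pair H x x) = pair H (?a x) (?a x)"
      using diag_mem[OF x] by (simp add: compression_def compose_def sE)
  qed (use diag_mem k in auto)
  moreover have "Re (cinner ?K (op_poly ?L q ?C (P ?f)) ?f)
      \<le> Re (cinner ?K (cfc ?K g ?D ?f) ?f) + e * (hnorm ?K ?f)\<^sup>2"
  proof (rule K.soc_compression[OF soc D D_form _ P _ M' q])
    show "max Mb s < 0" using Mb s by simp
    show "?f \<in> carrier ?K" using k by simp
    fix f assume "f \<in> P ` carrier ?K"
    then obtain x where x: "f = pair H x x" "x \<in> carrier H" using diagonal by blast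
    have "cinner ?K (?D f) f = cinner H (T x) x"
      using x E by (simp add: op_linear cinner_linear T(2))
    moreover have "(hnorm ?K f)\<^sup>2 = (hnorm H x)\<^sup>2 + Re (cinner H (E x) x)"
      using x by (simp add: pair_hnorm_square)
    ultimately show "m' * (hnorm ?K f)\<^sup>2 \<le> Re (cinner ?K (?D f) f)
        \<and> Re (cinner ?K (?D f) f) \<le> M' * (hnorm ?K f)\<^sup>2"
      using form'[OF x(2)] by simp
  qed
  moreover have "cinner ?K (cfc ?K g ?D ?f) ?f = cinner H (cfc H g b k) k"
    by (rule cfc_pair_diag[OF b Mb s cont k])
  moreover have "hnorm ?K ?f = hnorm H k" using k E by (simp add: pair_hnorm hnorm_def)
  moreover have "op_poly H q ?a (R k) \<in> carrier H" using a k by simp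
  ultimately show ?thesis using k unfolding Pf by simp
qed

end

context chilbert_space
begin

text \<open>If operators \<open>R\<^sub>n\<close> tend strongly to the identity, in the form that tolerates moving arguments, then
  each factor of \<open>q(R\<^sub>n T)\<close> converges in turn.\<close>

lemma op_poly_vlim:
  assumes T: "T \<in> bounded_ops H" and R: "\<And>n. R n \<in> bounded_ops H"
    and lim: "\<And>v y. \<lbrakk>\<And>n. v n \<in> carrier H; y \<in> carrier H; vlim v y\<rbrakk> \<Longrightarrow> vlim (\<lambda>n. R n (v n)) y"
    and u: "\<And>n. u n \<in> carrier H" "x \<in> carrier H" "vlim u x"
  shows "vlim (\<lambda>n. op_poly H p (compose (carrier H) (R n) T) (u n)) (op_poly H p T x)"
proof (induction p)
  case 0
  show ?case using u by (simp add: vlim_def)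
next
  case (pCons a p)
  let ?v = "\<lambda>n. op_poly H p (compose (carrier H) (R n) T) (u n)"
  have v: "?v n \<in> carrier H" for n using R T u by simp
  have y: "op_poly H p T x \<in> carrier H" using T u by simp
  have "vlim (\<lambda>n. T (?v n)) (T (op_poly H p T x))"
    by (rule vlim_op[OF v y pCons.IH T])
  from lim[OF op_closed[OF T v] op_closed[OF T y] this]
  have "vlim (\<lambda>n. R n (T (?v n))) (T (op_poly H p T x))" .
  from vlim_add[OF smult_cl[OF u(1)] smult_cl[OF u(2)] op_closed[OF R op_closed[OF T v]]
      op_closed[OF T y] vlim_smult[OF u] this]
  have "vlim (\<lambda>n. of_real a \<odot> u n \<oplus> R n (T (?v n))) (of_real a \<odot> x \<oplus> T (op_poly H p T x))" .
  moreover have "op_poly H (pCons a p) (compose (carrier H) (R n) T) (u n)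
      = of_real a \<odot> u n \<oplus> R n (T (?v n))" for n
    using op_poly_pCons[OF op_compose_bounded[OF R T] u(1)] v by (simp add: compose_eq)
  ultimately show ?case using T u by simp
qed

text \<open>The dilation with \<open>E\<^sub>n = -B / (n + 1)\<close> and \<open>s = -(n + 1)\<close>, so that \<open>A + s E\<^sub>n = A + B\<close>, in the limit
  \<open>n \<rightarrow> \<infinity>\<close>. The forms of all the compressions stay in one interval \<open>[-NT, M']\<close>, so one polynomial serves
  for all \<open>n\<close>.\<close>

lemma soc_cfc_antimono_add:
  assumes soc: "soc TYPE(nat \<Rightarrow> 'a) {..<0} g"
    and A: "A \<in> bounded_ops H" "self_adjoint H A" and dA: "dA > 0"
      "\<And>x. x \<in> carrier H \<Longrightarrow> Re (cinner H (A x) x) \<le> - dA * (hnorm H x)\<^sup>2"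
    and B: "B \<in> bounded_ops H" "self_adjoint H B" and dB: "dB > 0"
      "\<And>x. x \<in> carrier H \<Longrightarrow> Re (cinner H (B x) x) \<le> - dB * (hnorm H x)\<^sup>2"
    and k: "k \<in> carrier H"
  shows "Re (cinner H (cfc H g (op_add H A B) k) k) \<le> Re (cinner H (cfc H g A k) k)"
proof -
  let ?T = "op_add H A B"
  have T: "?T \<in> bounded_ops H" "self_adjoint H ?T"
  proof -
    show "?T \<in> bounded_ops H" using A(1) B(1) by simp
    have "cinner H (A x) y = cinner H x (A y)" "cinner H (B x) y = cinner H x (B y)"
      if "x \<in> carrier H" "y \<in> carrier H" for x y
      using A(2) B(2) that by (simp_all add: self_adjoint_def)
    then show "self_adjoint H ?T"
      using A(1) B(1) by (simp add: self_adjoint_def op_add_def cinner_linear)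
  qed
  have Tx: "cinner H (?T x) x = cinner H (A x) x + cinner H (B x) x" if "x \<in> carrier H" for x
    using that A B by (simp add: op_add_def cinner_linear)
  obtain NA where NA: "\<And>x. x \<in> carrier H \<Longrightarrow> - NA * (hnorm H x)\<^sup>2 \<le> Re (cinner H (A x) x)"
    using op_form_bound[OF A(1)] by blast
  obtain NB where NB: "NB > 0"
    "\<And>x. x \<in> carrier H \<Longrightarrow> hnorm H (B x) \<le> NB * hnorm H x"
    "\<And>x. x \<in> carrier H \<Longrightarrow> - NB * (hnorm H x)\<^sup>2 \<le> Re (cinner H (B x) x)"
    using op_form_bound[OF B(1)] by blast
  obtain NT where NT: "NT > 0"
    "\<And>x. x \<in> carrier H \<Longrightarrow> - NT * (hnorm H x)\<^sup>2 \<le> Re (cinner H (?T x) x)"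
    using op_form_bound[OF T(1)] by blast
  define \<epsilon> where "\<epsilon> n = inverse (real (Suc n))" for n
  have \<epsilon>: "\<epsilon> n > 0" "\<epsilon> n \<le> 1" "\<epsilon> \<longlonglongrightarrow> 0" for n
    unfolding \<epsilon>_def using LIMSEQ_inverse_real_of_nat by (auto simp: inverse_le_1_iff)
  define E where "E n = compose (carrier H) (op_scalar H (of_real (- \<epsilon> n))) B" for n
  have E: "E n \<in> bounded_ops H" for n using B by (simp add: E_def)
  have Ex: "E n x = of_real (- \<epsilon> n) \<odot> B x" if "x \<in> carrier H" for n x
    using that B by (simp add: E_def compose_def op_scalar_def)
  have E_form: "Re (cinner H (E n x) x) = - \<epsilon> n * Re (cinner H (B x) x)" if "x \<in> carrier H" for n x
    using that B by (simp add: Ex cinner_linear)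
  have E_sa: "self_adjoint H (E n)" for n
    using B by (auto simp: self_adjoint_def Ex cinner_linear)
  have E_coercive: "\<epsilon> n * dB * (hnorm H x)\<^sup>2 \<le> Re (cinner H (E n x) x)" if x: "x \<in> carrier H" for n x
    using mult_left_mono[OF dB(2)[OF x] less_imp_le[OF \<epsilon>(1)[of n]]] x by (simp add: E_form)
  have E_pos: "0 \<le> Re (cinner H (E n x) x)" if x: "x \<in> carrier H" for n x
    using E_coercive[OF x, of n] \<epsilon>(1)[of n] dB(1) by (meson mult_nonneg_nonneg less_imp_le order_trans zero_le_power2)
  have E_le: "Re (cinner H (E n x) x) \<le> NB * (hnorm H x)\<^sup>2" if x: "x \<in> carrier H" for n x
  proof -
    have "- Re (cinner H (B x) x) \<le> NB * (hnorm H x)\<^sup>2" using NB(3)[OF x] by simp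
    then have "\<epsilon> n * - Re (cinner H (B x) x) \<le> \<epsilon> n * (NB * (hnorm H x)\<^sup>2)"
      using \<epsilon>(1)[of n] by (intro mult_left_mono) auto
    also have "\<dots> \<le> 1 * (NB * (hnorm H x)\<^sup>2)"
      using \<epsilon>(2)[of n] NB(1) by (intro mult_right_mono) auto
    finally show ?thesis using x by (simp add: E_form)
  qed
  have ex_R: "\<exists>R\<in>bounded_ops H. \<forall>x\<in>carrier H. R x \<oplus> E n (R x) = x \<and> R (x \<oplus> E n x) = x" for n
  proof -
    let ?G = "op_add H (op_scalar H 1) (E n)"
    have G: "?G \<in> bounded_ops H" using E by simp
    have Gx: "?G x = x \<oplus> E n x" if "x \<in> carrier H" for x
      using that by (simp add: op_add_def op_scalar_def)
    have "op_invertible H ?G"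
      using E_pos E by (intro Lax_Milgram(1)[OF G, of 1 1]) (auto simp: Gx cinner_linear hnorm_square)
    then obtain R where R: "R \<in> bounded_ops H" "compose (carrier H) R ?G = op_scalar H 1"
      "compose (carrier H) ?G R = op_scalar H 1" by (auto simp: op_invertible_def)
    have "R x \<oplus> E n (R x) = x \<and> R (x \<oplus> E n x) = x" if x: "x \<in> carrier H" for x
      using fun_cong[OF R(2), of x] fun_cong[OF R(3), of x] x R(1) Gx[OF x] Gx[of "R x"]
      by (simp add: compose_def op_scalar_def)
    then show ?thesis using R(1) by blast
  qed
  then obtain R where R: "\<And>n. R n \<in> bounded_ops H"
    "\<And>n x. x \<in> carrier H \<Longrightarrow> R n x \<oplus> E n (R n x) = x"
    "\<And>n x. x \<in> carrier H \<Longrightarrow> R n (x \<oplus> E n x) = x" by metis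
  have R_contract: "hnorm H (R n z) \<le> hnorm H z" if z: "z \<in> carrier H" for n z
  proof -
    let ?r = "R n z"
    have r: "?r \<in> carrier H" "E n ?r \<in> carrier H" using R(1) E z by auto
    have "(hnorm H ?r)\<^sup>2 \<le> Re (cinner H (?r \<oplus> E n ?r) ?r)"
      using E_pos[OF r(1), of n] r by (simp add: cinner_linear hnorm_square)
    also have "\<dots> \<le> hnorm H z * hnorm H ?r"
      using Re_cinner_le[OF z r(1)] R(2)[OF z, of n] by simp
    finally show ?thesis
      using hnorm_ge0[OF r(1)] hnorm_ge0[OF z] by (cases "hnorm H ?r = 0") (auto simp: power2_eq_square)
  qed
  have R_lim: "vlim (\<lambda>n. R n (v n)) y" if v: "\<And>n. v n \<in> carrier H" "y \<in> carrier H" "vlim v y" for v y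
  proof (rule vlimI[where b = "\<lambda>n. hnorm H (v n \<ominus> y) + \<epsilon> n * (NB * hnorm H y)"])
    fix n
    let ?r = "R n y"
    have r: "?r \<in> carrier H" "B ?r \<in> carrier H" using R(1) B v by auto
    have "R n (v n) \<ominus> ?r = R n (v n \<ominus> y)" using R(1) v by (simp add: op_linear)
    then have 1: "hnorm H (R n (v n) \<ominus> ?r) \<le> hnorm H (v n \<ominus> y)"
      using R_contract[of "v n \<ominus> y" n] v by simp
    have "?r \<ominus> y = ?r \<ominus> (?r \<oplus> E n ?r)" using R(2)[OF v(2)] by simp
    also have "\<dots> = of_real (\<epsilon> n) \<odot> B ?r"
      using r by (intro cinner_ext) (auto simp: Ex cinner_linear)
    finally have "hnorm H (?r \<ominus> y) = \<epsilon> n * hnorm H (B ?r)" using r \<epsilon>(1)[of n] by simp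
    also have "\<dots> \<le> \<epsilon> n * (NB * hnorm H y)"
      using NB(2)[OF r(1)] R_contract[OF v(2), of n] NB(1) \<epsilon>(1)[of n]
      by (intro mult_left_mono order_trans[OF NB(2)[OF r(1)]]) auto
    finally show "hnorm H (R n (v n) \<ominus> y) \<le> hnorm H (v n \<ominus> y) + \<epsilon> n * (NB * hnorm H y)"
      using 1 hnorm_diff_triangle[of "R n (v n)" ?r y] R(1) v r by simp
    show "R n (v n) \<in> carrier H" using R(1) v by simp
  next
    show "(\<lambda>n. hnorm H (v n \<ominus> y) + \<epsilon> n * (NB * hnorm H y)) \<longlonglongrightarrow> 0"
      using tendsto_add[OF v(3)[unfolded vlim_def] tendsto_mult_left_zero[OF \<epsilon>(3)]] by simp
  qed (use v in auto)
  \<comment> \<open>The pair \<open>(x, x)\<close> has squared norm at most \<open>(1 + NB) |x|\<^sup>2\<close>, because \<open>E n \<le> NB\<close> for all \<open>n\<close>.\<close>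
  define M' where "M' = - dA / (1 + NB)"
  have M': "M' < 0" using dA NB by (simp add: M'_def)
  have T_upper: "Re (cinner H (?T x) x) \<le> - dA * (hnorm H x)\<^sup>2" if x: "x \<in> carrier H" for x
    using dA(2)[OF x] dB(2)[OF x] Tx[OF x]
      mult_nonneg_nonneg[OF less_imp_le[OF dB(1)] zero_le_power2[of "hnorm H x"]] by simp
  have form': "- NT * ((hnorm H x)\<^sup>2 + Re (cinner H (E n x) x)) \<le> Re (cinner H (?T x) x)
      \<and> Re (cinner H (?T x) x) \<le> M' * ((hnorm H x)\<^sup>2 + Re (cinner H (E n x) x))"
    if x: "x \<in> carrier H" for n x
  proof
    have "- NT * ((hnorm H x)\<^sup>2 + Re (cinner H (E n x) x)) \<le> - NT * (hnorm H x)\<^sup>2"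
      using NT(1) E_pos[OF x, of n] by (simp add: distrib_left)
    then show "- NT * ((hnorm H x)\<^sup>2 + Re (cinner H (E n x) x)) \<le> Re (cinner H (?T x) x)"
      using NT(2)[OF x] by linarith
    have "- M' * ((hnorm H x)\<^sup>2 + Re (cinner H (E n x) x)) \<le> - M' * ((1 + NB) * (hnorm H x)\<^sup>2)"
      using M' E_le[OF x, of n] by (intro mult_left_mono) (auto simp: algebra_simps)
    also have "\<dots> = dA * (hnorm H x)\<^sup>2" using NB(1) by (simp add: M'_def)
    finally show "Re (cinner H (?T x) x) \<le> M' * ((hnorm H x)\<^sup>2 + Re (cinner H (E n x) x))"
      using T_upper[OF x] by simp
  qed
  have T_form: "- NT * (hnorm H x)\<^sup>2 \<le> Re (cinner H (?T x) x)
      \<and> Re (cinner H (?T x) x) \<le> M' * (hnorm H x)\<^sup>2" if x: "x \<in> carrier H" for x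
  proof -
    have "M' * ((hnorm H x)\<^sup>2 + Re (cinner H (E 0 x) x)) \<le> M' * (hnorm H x)\<^sup>2"
      using M' E_pos[OF x, of 0] by (simp add: distrib_left mult_le_0_iff)
    then show ?thesis using form'[OF x, of 0] NT(2)[OF x] by linarith
  qed
  have A_form: "- NA * (hnorm H x)\<^sup>2 \<le> Re (cinner H (A x) x)
      \<and> Re (cinner H (A x) x) \<le> - dA * (hnorm H x)\<^sup>2" if "x \<in> carrier H" for x
    using NA[OF that] dA(2)[OF that] by simp
  have cont: "continuous_on {..<0} g" using soc by (simp add: soc_def)
  have g: "continuous_on {- NT..M'} g"
    by (intro continuous_on_subset[OF cont]) (use M' in auto)
  show ?thesis
  proof (rule le_of_le_add_mult)
    fix e :: real assume e: "e > 0"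
    obtain q where q: "\<And>t. t \<in> {- NT..M'} \<Longrightarrow> \<bar>poly q t - g t\<bar> < e"
      using Weierstrass_real_poly[OF g e] by blast
    have q': "\<bar>poly q t - g t\<bar> \<le> e" if "t \<in> {- NT..M'}" for t
      using q[OF that] by simp
    let ?w = "\<lambda>n. op_poly H q (compose (carrier H) (R n) ?T) (R n k)"
    let ?c = "Re (cinner H (cfc H g A k) k) + e * (hnorm H k)\<^sup>2"
    have w: "?w n \<in> carrier H" for n using R(1) T(1) k by simp
    have Tk: "op_poly H q ?T k \<in> carrier H" using T(1) k by simp
    have bound: "Re (cinner H (?w n) k) \<le> ?c" for n
    proof -
      interpret coercive_op H "E n" "\<epsilon> n * dB"
        using E E_sa E_coercive \<epsilon>(1) dB(1) by unfold_locales auto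
      show ?thesis
      proof (rule soc_dilation[OF soc A A_form _ _ R(1) R(2) R(3) T(1) _ form' M' q' _ k])
        show "- dA < 0" "- 1 / \<epsilon> n < 0" "0 \<le> e" using dA(1) \<epsilon>(1) e by auto
        fix x assume x: "x \<in> carrier H"
        show "?T x = A x \<oplus> complex_of_real (- 1 / \<epsilon> n) \<odot> E n x"
          using x A B \<epsilon>(1)[of n] by (simp add: op_add_def Ex smult_smult flip: of_real_mult)
      qed
    qed
    have "vlim (\<lambda>n. R n k) k"
      using k by (intro R_lim) (auto simp: vlim_def)
    from op_poly_vlim[OF T(1) R(1) R_lim op_closed[OF R(1) k] k this]
    have "vlim ?w (op_poly H q ?T k)" .
    then have "(\<lambda>n. ?c + hnorm H (?w n \<ominus> op_poly H q ?T k) * hnorm H k) \<longlonglongrightarrow> ?c + 0 * hnorm H k"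
      unfolding vlim_def by (intro tendsto_intros)
    moreover have "Re (cinner H (op_poly H q ?T k) k)
        \<le> ?c + hnorm H (?w n \<ominus> op_poly H q ?T k) * hnorm H k" for n
      using bound[of n] Re_cinner_le[of "?w n \<ominus> op_poly H q ?T k" k] w Tk k by (simp add: cinner_linear)
    ultimately have "Re (cinner H (op_poly H q ?T k) k) \<le> ?c"
      by (intro LIMSEQ_le_const[of _ ?c]) auto
    moreover have "cmod (cinner H (op_poly H q ?T k) k - cinner H (cfc H g ?T k) k)
        \<le> e * hnorm H k * hnorm H k"
      using e by (intro cfc_form_approx[OF T T_form g q' _ k k]) auto
    then have "Re (cinner H (cfc H g ?T k) k) - Re (cinner H (op_poly H q ?T k) k) \<le> e * (hnorm H k)\<^sup>2"
      using abs_Re_le_cmod[of "cinner H (op_poly H q ?T k) k - cinner H (cfc H g ?T k) k"]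
      by (simp add: power2_eq_square mult.assoc)
    ultimately show "Re (cinner H (cfc H g ?T k) k)
        \<le> Re (cinner H (cfc H g A k) k) + e * (2 * (hnorm H k)\<^sup>2)"
      by (simp add: algebra_simps)
  qed simp
qed

end

section \<open>Negative invertible operators\<close>

context chilbert_space
begin

text \<open>Polarization: the form being real at \<open>x + y\<close> and at \<open>x + \<i> y\<close> gives both parts of
  \<open>\<langle>T y, x\<rangle> = cnj \<langle>T x, y\<rangle>\<close>.\<close>

lemma self_adjoint_if_real_form:
  assumes T: "T \<in> bounded_ops H" and real: "\<And>x. x \<in> carrier H \<Longrightarrow> Im (cinner H (T x) x) = 0"
  shows "self_adjoint H T"
  unfolding self_adjoint_def
proof (intro ballI)
  fix x y assume xy: "x \<in> carrier H" "y \<in> carrier H"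
  have cl: "T x \<in> carrier H" "T y \<in> carrier H" using T xy by auto
  have "Im (cinner H (T (x \<oplus> y)) (x \<oplus> y)) = 0" using xy by (intro real) simp
  then have 1: "Im (cinner H (T x) y) = - Im (cinner H (T y) x)"
    using xy cl T by (simp add: op_linear cinner_linear real)
  have "Im (cinner H (T (x \<oplus> \<i> \<odot> y)) (x \<oplus> \<i> \<odot> y)) = 0" using xy by (intro real) simp
  then have 2: "Re (cinner H (T x) y) = Re (cinner H (T y) x)"
    using xy cl T by (simp add: op_linear cinner_linear real)
  show "cinner H (T x) y = cinner H x (T y)"
    using 1 2 cinner_commute[OF xy(1) cl(2)] by (simp add: complex_eq_iff)
qed

lemma neg_op_form:
  assumes T: "T \<in> bounded_ops H" and neg: "neg_op H T" and x: "x \<in> carrier H"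
  shows "Im (cinner H (T x) x) = 0" "Re (cinner H (T x) x) \<le> 0"
proof -
  have "cinner H (\<ominus> T x) x \<in> \<real>\<^sub>\<ge>\<^sub>0"
    using neg x by (simp add: neg_op_def pos_op_def op_uminus_def)
  then have "- cinner H (T x) x \<in> \<real>\<^sub>\<ge>\<^sub>0"
    using T x by (simp add: uminus_eq_smult cinner_linear)
  then show "Im (cinner H (T x) x) = 0" "Re (cinner H (T x) x) \<le> 0"
    by (auto simp: complex_nonneg_Reals_iff)
qed

text \<open>Cauchy-Schwarz for the form of \<open>-T\<close> turns boundedness below into coercivity.\<close>

lemma neg_invertible_coercive:
  assumes T: "T \<in> bounded_ops H" and neg: "neg_op H T" and inv: "op_invertible H T"
  obtains d where "d > 0" "\<And>x. x \<in> carrier H \<Longrightarrow> Re (cinner H (T x) x) \<le> - d * (hnorm H x)\<^sup>2"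
proof -
  have sa: "self_adjoint H T" using neg_op_form(1)[OF T neg] by (rule self_adjoint_if_real_form[OF T])
  obtain c where c: "c > 0" "\<And>x. x \<in> carrier H \<Longrightarrow> c * hnorm H x \<le> hnorm H (T x)"
    using op_invertible_below[OF T inv] by blast
  define S where "S = compose (carrier H) (op_scalar H (-1)) T"
  have S: "S \<in> bounded_ops H" using T by (simp add: S_def)
  have Sx: "S x = (-1) \<odot> T x" if "x \<in> carrier H" for x
    using that T by (simp add: S_def compose_def op_scalar_def)
  have S_sa: "self_adjoint H S" using sa T by (auto simp: self_adjoint_def Sx cinner_linear)
  have form: "cinner H (S x) x = - cinner H (T x) x" if "x \<in> carrier H" for x
    using that T by (simp add: Sx cinner_linear)
  have pos: "0 \<le> Re (cinner H (S x) x)" if "x \<in> carrier H" for x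
    using neg_op_form(2)[OF T neg that] that by (simp add: form)
  obtain M where M: "M > 0" "\<And>x. x \<in> carrier H \<Longrightarrow> hnorm H (S x) \<le> M * hnorm H x"
    using op_bound[OF S] by blast
  have "Re (cinner H (T x) x) \<le> - (c\<^sup>2 / M) * (hnorm H x)\<^sup>2" if x: "x \<in> carrier H" for x
  proof -
    have "(c * hnorm H x)\<^sup>2 \<le> (hnorm H (S x))\<^sup>2"
      using c x T by (intro power_mono) (auto simp: Sx)
    also have "\<dots> \<le> M * Re (cinner H (S x) x)" by (rule positive_op_norm_bound[OF S S_sa pos M x])
    finally show ?thesis using M(1) x by (simp add: form power_mult_distrib field_simps)
  qed
  then show ?thesis using that[of "c\<^sup>2 / M"] c M by simp
qed

text \<open>With \<open>y = (l - B)\<^sup>-\<^sup>1 A x\<close> the form is \<open>\<langle>A y, x\<rangle> = \<langle>y, A x\<rangle> = \<langle>y, (l - B) y\<rangle>\<close>. Surjectivity of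
  \<open>l - B\<close> matters here, since \<^const>\<open>op_inverse\<close> is arbitrary off the range.\<close>

lemma resolvent_sandwich_nonneg:
  assumes A: "A \<in> bounded_ops H" "self_adjoint H A"
    and B: "B \<in> bounded_ops H" "neg_op H B" "op_invertible H B" and l: "0 \<le> l" and x: "x \<in> carrier H"
  defines "R \<equiv> op_inverse H (op_diff H (op_scalar H (complex_of_real l)) B)"
  shows "R (A x) \<in> carrier H" "cinner H (A (R (A x))) x \<in> \<real>\<^sub>\<ge>\<^sub>0"
proof -
  let ?S = "op_diff H (op_scalar H (complex_of_real l)) B"
  obtain d where d: "d > 0" "\<And>x. x \<in> carrier H \<Longrightarrow> Re (cinner H (B x) x) \<le> - d * (hnorm H x)\<^sup>2"
    using neg_invertible_coercive[OF B] by blast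
  have S: "?S \<in> bounded_ops H" using B by simp
  have form: "cinner H (?S y) y = of_real (l * (hnorm H y)\<^sup>2) - cinner H (B y) y" if "y \<in> carrier H" for y
    using that B by (simp add: op_diff_def op_scalar_def cinner_linear cinner_self)
  have "d * (hnorm H y)\<^sup>2 \<le> Re (1 * cinner H (?S y) y)" if y: "y \<in> carrier H" for y
    using d(2)[OF y] mult_nonneg_nonneg[OF l zero_le_power2[of "hnorm H y"]]
    unfolding mult_1_left form[OF y] minus_complex.sel Re_complex_of_real by linarith
  from Lax_Milgram(2)[OF S _ d(1) this] have bij: "bij_betw ?S (carrier H) (carrier H)" by simp
  have Ax: "A x \<in> carrier H" using A x by simp
  let ?y = "R (A x)"
  have y: "?y \<in> carrier H" "?S ?y = A x"
    using bij Ax by (auto simp: R_def op_inverse_def bij_betw_def inv_into_into f_inv_into_f)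
  show "R (A x) \<in> carrier H" by (rule y)
  have "cinner H (A ?y) x = cinner H ?y (A x)" using A x y by (simp add: self_adjoint_def)
  also have "\<dots> = cnj (cinner H (?S ?y) ?y)" using y cinner_commute[OF y(1) Ax] by simp
  finally show "cinner H (A ?y) x \<in> \<real>\<^sub>\<ge>\<^sub>0"
    using neg_op_form[OF B(1,2) y(1)] mult_nonneg_nonneg[OF l zero_le_power2[of "hnorm H ?y"]]
    unfolding form[OF y(1)] by (simp add: complex_nonneg_Reals_iff)
qed

lemma cfc_real_form:
  assumes T: "T \<in> bounded_ops H" and sa: "self_adjoint H T"
    and form: "\<And>x. x \<in> carrier H \<Longrightarrow> m * (hnorm H x)\<^sup>2 \<le> Re (cinner H (T x) x)
      \<and> Re (cinner H (T x) x) \<le> M * (hnorm H x)\<^sup>2"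
    and g: "continuous_on {m..M} g" and x: "x \<in> carrier H"
  shows "Im (cinner H (cfc H g T x) x) = 0"
proof -
  have "\<bar>Im (cinner H (cfc H g T x) x)\<bar> \<le> 0"
  proof (rule le_of_le_add_mult)
    fix e :: real assume e: "e > 0"
    obtain q where q: "\<And>t. t \<in> {m..M} \<Longrightarrow> \<bar>poly q t - g t\<bar> < e"
      using Weierstrass_real_poly[OF g e] by blast
    let ?z = "cinner H (op_poly H q T x) x - cinner H (cfc H g T x) x"
    have "\<bar>Im ?z\<bar> \<le> e * hnorm H x * hnorm H x"
      using q e by (intro order_trans[OF abs_Im_le_cmod] cfc_form_approx[OF T sa form g _ _ x x])
        (auto intro!: less_imp_le)
    moreover have "Im (cinner H (op_poly H q T x) x) = 0"
      using T sa x by (intro self_adjoint_Im op_poly_self_adjoint) auto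
    ultimately show "\<bar>Im (cinner H (cfc H g T x) x)\<bar> \<le> 0 + e * (hnorm H x)\<^sup>2"
      by (simp add: power2_eq_square mult.assoc)
  qed simp
  then show ?thesis by simp
qed

end

section \<open>The equivalence\<close>

theorem theorem2p4:
  fixes H :: "'a chilbert" and g :: "real \<Rightarrow> real" and A B :: "'a \<Rightarrow> 'a"
  assumes "chilbert_space H" and "carrier H \<noteq> {\<zero>\<^bsub>H\<^esub>}"
    and "soc TYPE(nat \<Rightarrow> 'a) {..<0} g" and "\<exists>t<0. g t \<noteq> 0"
    and "A \<in> bounded_ops H" and "neg_op H A" and "op_invertible H A"
    and "B \<in> bounded_ops H" and "neg_op H B" and "op_invertible H B"
  shows "op_le H (cfc H g (op_add H A B)) (op_add H (cfc H g A) (cfc H g B)) \<longleftrightarrow>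
    (\<forall>l::real. 0 \<le> l \<longrightarrow> pos_op H (op_add H
       (compose (carrier H) A
          (compose (carrier H) (op_inverse H (op_diff H (op_scalar H (complex_of_real l)) B)) A))
       (compose (carrier H) B
          (compose (carrier H) (op_inverse H (op_diff H (op_scalar H (complex_of_real l)) A)) B))))"
proof -
  interpret chilbert_space H by fact
  note soc = assms(3) and A = assms(5-7) and B = assms(8-10)
  have A_sa: "self_adjoint H A" and B_sa: "self_adjoint H B"
    using self_adjoint_if_real_form neg_op_form(1) A B by blast+
  obtain a where a: "a > 0" "\<And>x. x \<in> carrier H \<Longrightarrow> Re (cinner H (A x) x) \<le> - a * (hnorm H x)\<^sup>2"
    using neg_invertible_coercive[OF A] by blast
  obtain b where b: "b > 0" "\<And>x. x \<in> carrier H \<Longrightarrow> Re (cinner H (B x) x) \<le> - b * (hnorm H x)\<^sup>2"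
    using neg_invertible_coercive[OF B] by blast
  let ?T = "op_add H A B"
  have T: "?T \<in> bounded_ops H" using A B by simp
  have Tx: "cinner H (?T x) x = cinner H (A x) x + cinner H (B x) x" if "x \<in> carrier H" for x
    using that A B by (simp add: op_add_def cinner_linear)
  have T_sa: "self_adjoint H ?T"
    using Tx neg_op_form(1)[OF A(1,2)] neg_op_form(1)[OF B(1,2)]
    by (intro self_adjoint_if_real_form[OF T]) simp
  have T_neg: "Re (cinner H (?T x) x) \<le> - a * (hnorm H x)\<^sup>2" if "x \<in> carrier H" for x
    using a(2)[OF that] neg_op_form(2)[OF B(1,2) that] Tx[OF that] by simp
  have cont: "continuous_on {..<0} g" using soc by (simp add: soc_def)
  have cfc: "cfc H g S \<in> bounded_ops H \<and> (\<forall>x\<in>carrier H. Im (cinner H (cfc H g S x) x) = 0)"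
    if S: "S \<in> bounded_ops H" "self_adjoint H S" and c: "c > 0"
      and neg: "\<And>x. x \<in> carrier H \<Longrightarrow> Re (cinner H (S x) x) \<le> - c * (hnorm H x)\<^sup>2" for S c
  proof -
    obtain m where form: "\<And>x. x \<in> carrier H \<Longrightarrow> - m * (hnorm H x)\<^sup>2 \<le> Re (cinner H (S x) x)"
      using op_form_bound[OF S(1)] by blast
    have g: "continuous_on {- m..- c} g"
      by (intro continuous_on_subset[OF cont]) (use c in auto)
    show ?thesis
      using cfc_approx(1)[OF S _ g] cfc_real_form[OF S _ g] form neg by blast
  qed
  note cfcA = cfc[OF A(1) A_sa a] and cfcB = cfc[OF B(1) B_sa b] and cfcT = cfc[OF T T_sa a(1) T_neg]
  have "op_le H (cfc H g ?T) (op_add H (cfc H g A) (cfc H g B))"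
    unfolding op_le_def pos_op_def
  proof
    fix x assume x: "x \<in> carrier H"
    have mono: "Re (cinner H (cfc H g ?T x) x) \<le> Re (cinner H (cfc H g A x) x)"
      by (rule soc_cfc_antimono_add[OF soc A(1) A_sa a B(1) B_sa b x])
    have nonneg: "0 \<le> Re (cinner H (cfc H g B x) x)"
    proof -
      obtain m where form: "\<And>x. x \<in> carrier H \<Longrightarrow> - m * (hnorm H x)\<^sup>2 \<le> Re (cinner H (B x) x)"
        using op_form_bound[OF B(1)] by blast
      interpret coercive_op H "op_scalar H 1" 1
      proof unfold_locales
        have "op_scalar H 1 y = y" if "y \<in> carrier H" for y
          using that by (simp add: op_scalar_def)
        then show "self_adjoint H (op_scalar H 1)"
          and "\<And>y. y \<in> carrier H \<Longrightarrow> 1 * (hnorm H y)\<^sup>2 \<le> Re (cinner H (op_scalar H 1 y) y)"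
          by (simp_all add: self_adjoint_def hnorm_square)
      qed simp_all
      have B_form: "- m * (hnorm H y)\<^sup>2 \<le> Re (cinner H (B y) y)
          \<and> Re (cinner H (B y) y) \<le> - b * (hnorm H y)\<^sup>2" if "y \<in> carrier H" for y
        using form[OF that] b(2)[OF that] by simp
      have neg: "- b < 0" "(-1 :: real) < 0" using b(1) by auto
      show ?thesis by (rule soc_cfc_nonneg[OF B(1) B_sa B_form neg soc x])
    qed
    have eq: "cinner H (op_diff H (op_add H (cfc H g A) (cfc H g B)) (cfc H g ?T) x) x
        = cinner H (cfc H g A x) x + cinner H (cfc H g B x) x - cinner H (cfc H g ?T x) x"
      using x cfcA cfcB cfcT
      by (simp add: op_diff_def op_add_def[of H "cfc H g A" "cfc H g B"] cinner_linear)
    show "cinner H (op_diff H (op_add H (cfc H g A) (cfc H g B)) (cfc H g ?T) x) x \<in> \<real>\<^sub>\<ge>\<^sub>0"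
      unfolding eq using mono nonneg x cfcA cfcB cfcT by (simp add: complex_nonneg_Reals_iff)
  qed
  moreover have "pos_op H (op_add H
       (compose (carrier H) A
          (compose (carrier H) (op_inverse H (op_diff H (op_scalar H (complex_of_real l)) B)) A))
       (compose (carrier H) B
          (compose (carrier H) (op_inverse H (op_diff H (op_scalar H (complex_of_real l)) A)) B)))"
    if l: "0 \<le> l" for l
    unfolding pos_op_def
  proof
    fix x assume x: "x \<in> carrier H"
    note AB = resolvent_sandwich_nonneg[OF A(1) A_sa B l x]
      and BA = resolvent_sandwich_nonneg[OF B(1) B_sa A l x]
    show "cinner H (op_add H
       (compose (carrier H) A
          (compose (carrier H) (op_inverse H (op_diff H (op_scalar H (complex_of_real l)) B)) A))
       (compose (carrier H) B
          (compose (carrier H) (op_inverse H (op_diff H (op_scalar H (complex_of_real l)) A)) B)) x) x \<in> \<real>\<^sub>\<ge>\<^sub>0"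
      using AB BA x A(1) B(1)
      by (simp add: op_add_def compose_eq cinner_add_left nonneg_Reals_add_I)
  qed
  ultimately show ?thesis by blast
qed

end
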